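(* Let $a\in\mathbb Q^+\setminus\{1\}$, write $a=a_0^h$ with $a_0\in\mathbb Q^+$ not a power of any rational number and $h\in\mathbb N$, and write $a_0=a_1a_2^2$ with $a_2\in\mathbb Q^+$ and $a_1>1$ a squarefree positive integer. Let $m\in\mathbb N$ and let $A=\prod_{\ell}\left(1-\frac1{\ell^2-\ell}\right)$ be Artin's constant. Then $$\rho(\langle -1,a\rangle,m)=\frac{(m,h)}{2m^2}\prod_{\ell\mid 2m}\frac{\ell^2-\ell}{\ell^2-\ell-1}\prod_{\substack{\ell\mid h\\ \ell\nmid 2m}}\frac{\ell^2-2\ell}{\ell^2-\ell-1}\prod_{\substack{\ell\mid 2m\\ v_\ell(m/h)\ge0}}\frac{\ell+1}{\ell}\left(1+\tau_{a,m}\prod_{\substack{\ell\mid a_1\\ \ell\nmid 2m}}\frac{-(\ell,h)}{\ell^2-\ell-(\ell,h)}\right)A,$$ where $\tau_{a,m}=0$ if $v_2(h)>v_2(m)$, or if $v_2(h)=v_2(m)=0$ and $2\mid ha_1$; $\tau_{a,m}=-\frac13$ if $v_2(h)=v_2(m)=0$ and $2\nmid ha_1$, or if $v_2(h)=v_2(m)>0$, or if $v_2(h)<v_2(m)=1$ and $2\mid ha_1$; $\tau_{a,m}=1$ if $v_2(h)<v_2(m)=1$ and $2\nmid ha_1$, or if $v_2(h)<v_2(m)\ne1$.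
   Context: $\ell$ runs over primes, $v_\ell$ is the $\ell$-adic valuation, $(x,y)=\gcd(x,y)$, $\mu$ the Möbius function, $\zeta_d=e^{2\pi i/d}$. For a finitely generated $\Gamma\subset\mathbb Q^*$, $\Gamma^{1/d}=\{\alpha\in\mathbb R:\alpha^d\in\Gamma\}$ and $$\rho(\Gamma,m)=\sum_{k\ge1}\frac{\mu(k)}{[\mathbb Q(\zeta_{mk},\Gamma^{1/mk}):\mathbb Q]}.$$
   Formalization: Γ^{1/d} is taken to be all complex α with α^d ∈ Γ, not only the real ones; with real roots the formula fails, e.g. for a = 2, m = 1 the series equals A while the right-hand side is (3/2)A. *)

theory Defs
  imports
    "HOL-Algebra.Algebraic_Closure_Type"
    "HOL-Algebra.Generated_Fields"
    "HOL-Analysis.Infinite_Products"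
    "HOL-Computational_Algebra.Squarefree"
begin

definition moebius :: "nat \<Rightarrow> int" where
  "moebius k = (if squarefree k then (- 1) ^ card (prime_factors k) else 0)"

text \<open>The valuation of a nonzero rational; \<^const>\<open>quotient_of\<close> gives it in lowest terms.\<close>

definition val :: "nat \<Rightarrow> rat \<Rightarrow> int" where
  "val l q = int (multiplicity (int l) (fst (quotient_of q)))
           - int (multiplicity (int l) (snd (quotient_of q)))"

abbreviation rat_units :: "rat monoid" where
  "rat_units \<equiv> mult_of (ring_of_type_algebra :: rat ring)"

abbreviation complex_field :: "complex ring" where
  "complex_field \<equiv> ring_of_type_algebra"

definition zeta :: "nat \<Rightarrow> complex" where
  "zeta d = exp (2 * of_real pi * \<i> / of_nat d)"

text \<open>
  All complex \<open>d\<close>-th roots are taken, not only the real ones. For \<open>\<Gamma>\<close> containing negative numbers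
  this matters: the real \<open>d\<close>-th roots of elements of \<open>\<langle>-1, a\<rangle>\<close> with \<open>a > 0\<close> are, up to sign, those of
  powers of \<open>a\<close>, so that \<open>-1\<close> would not contribute to the fields below at all, whereas
  it must contribute the \<open>2d\<close>-th roots of unity: for \<open>a = 2\<close>, \<open>m = 1\<close> real roots alone would make the
  series below sum to Artin's constant instead of \<open>3/2\<close> times it.
\<close>

definition roots :: "rat set \<Rightarrow> nat \<Rightarrow> complex set" where
  "roots \<Gamma> d = {\<alpha>. \<alpha> ^ d \<in> of_rat ` \<Gamma>}"

definition kummer_field :: "rat set \<Rightarrow> nat \<Rightarrow> complex set" where
  "kummer_field \<Gamma> d = generate_field complex_field (insert (zeta d) (roots \<Gamma> d))"

definition rho :: "rat set \<Rightarrow> nat \<Rightarrow> real" where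
  "rho \<Gamma> m = (\<Sum>k. of_int (moebius (Suc k)) /
      of_nat (ring.dim complex_field \<rat> (kummer_field \<Gamma> (m * Suc k))))"

definition artin_constant :: real where
  "artin_constant = (\<Prod>l. if prime l then 1 - 1 / ((of_nat l)\<^sup>2 - of_nat l) else 1)"

definition tau :: "nat \<Rightarrow> nat \<Rightarrow> nat \<Rightarrow> real" where
  "tau h a1 m =
    (let vh = multiplicity 2 h; vm = multiplicity 2 m in
     if vh > vm \<or> (vh = 0 \<and> vm = 0 \<and> 2 dvd h * a1) then 0
     else if (vh = 0 \<and> vm = 0 \<and> \<not> 2 dvd h * a1) \<or> (vh = vm \<and> vm > 0)
           \<or> (vh < vm \<and> vm = 1 \<and> 2 dvd h * a1) then - 1 / 3
     else 1)"

text \<open>The three cases are mutually exclusive, and the last one is the following.\<close>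

lemma tau_eq_1_iff:
  "tau h a1 m = 1 \<longleftrightarrow>
    (multiplicity 2 h < multiplicity 2 m \<and> multiplicity 2 m = 1 \<and> \<not> 2 dvd h * a1)
    \<or> (multiplicity 2 h < multiplicity 2 m \<and> multiplicity 2 m \<noteq> 1)"
  unfolding tau_def Let_def by (simp only: split: if_splits) auto

lemma tau_eq_minus_third_iff:
  "tau h a1 m = - 1 / 3 \<longleftrightarrow>
    (multiplicity 2 h = 0 \<and> multiplicity 2 m = 0 \<and> \<not> 2 dvd h * a1)
    \<or> (multiplicity 2 h = multiplicity 2 m \<and> multiplicity 2 m > 0)
    \<or> (multiplicity 2 h < multiplicity 2 m \<and> multiplicity 2 m = 1 \<and> 2 dvd h * a1)"
  unfolding tau_def Let_def by (simp only: split: if_splits) auto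

end

theory Submission
  imports Defs "HOL-Number_Theory.Number_Theory"
begin

text \<open>
  The field of level \<open>d\<close> is \<open>\<rat>(\<zeta>\<^bsub>2d\<^esub>, a\<^sub>0\<^bsup>1/N\<^esup>)\<close> with \<open>N = d / gcd(d, h)\<close>. Over the cyclotomic field
  \<open>\<rat>(\<zeta>\<^bsub>2d\<^esub>)\<close>, which contains the \<open>2N\<close>-th roots of unity, the degree of \<open>\<alpha> = a\<^sub>0\<^bsup>1/N\<^esup>\<close> is the least \<open>s > 0\<close>
  for which \<open>\<alpha>\<^sup>s\<close> is cyclotomic. A real radical in a cyclotomic field has rational square, since its
  conjugates are again real and so agree with it up to sign; as \<open>a\<^sub>0\<close> is not a perfect power, \<open>s\<close> is \<open>N\<close>
  or \<open>N/2\<close>, and it is \<open>N/2\<close> exactly when \<open>N\<close> is even and \<open>\<surd>a\<^sub>1\<close> lies in the cyclotomic field. The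
  reciprocal degrees are therefore a multiplicative function of \<open>k\<close>, plus (unless \<open>\<surd>a\<^sub>1\<close> never matters)
  the same function restricted to the multiples of a fixed squarefree number, and both sums are Euler
  products.
\<close>

section \<open>Conjugates of roots of unity\<close>

text \<open>Automorphisms never appear as maps. An element of a cyclotomic field is written f(z) / M
  with an integer polynomial f, a relation between such elements is the vanishing of an integer
  polynomial at z, and conjugation is the passage from z to z^j, under which relations survive.
  Integer coefficients make reduction modulo a prime available, on which both this invariance and
  the criterion for square roots rest.

  The order 2d comes from -1 in the group, since \<open>zeta (2 * d)\<close> is a d-th root of -1.
  When N is even, 4 divides 2d, so i is in the field and signs under the square root are harmless.

  The values of \<open>tau\<close> come from the restricted sum: requiring a set Q of primes to
  divide k multiplies the Euler product of the factors 1 + t by the product of t / (1 + t) over Q.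
  Besides the primes of a1 not dividing 2m, Q contains 2 if the degree drops only for even k. Then t
  = -1/4 at 2, which gives -1/3; without 2 in Q the value is 1, and it is 0 if no squarefree k
  lowers the degree.\<close>

abbreviation ipoly :: "int poly \<Rightarrow> complex \<Rightarrow> complex" where
  "ipoly f z \<equiv> poly (map_poly of_int f) z"

lemma map_poly_of_int_add:
  "map_poly (of_int :: int \<Rightarrow> complex) (f + g) = map_poly of_int f + map_poly of_int g"
  by (simp add: poly_eq_iff coeff_map_poly)

lemma map_poly_of_int_mult:
  "map_poly (of_int :: int \<Rightarrow> complex) (f * g) = map_poly of_int f * map_poly of_int g"
  by (simp add: poly_eq_iff coeff_map_poly coeff_mult)

lemma map_poly_of_int_smult:
  "map_poly (of_int :: int \<Rightarrow> complex) (smult c f) = smult (of_int c) (map_poly of_int f)"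
  by (simp add: poly_eq_iff coeff_map_poly)

lemma ipoly_add: "ipoly (f + g) z = ipoly f z + ipoly g z"
  by (simp add: map_poly_of_int_add)

lemma ipoly_uminus: "ipoly (- f) z = - ipoly f z"
proof -
  have "map_poly of_int (- f) = - map_poly (of_int :: int \<Rightarrow> complex) f"
    by (simp add: poly_eq_iff coeff_map_poly)
  then show ?thesis by simp
qed

lemma ipoly_diff: "ipoly (f - g) z = ipoly f z - ipoly g z"
  using ipoly_add[of f "- g" z] by (simp add: ipoly_uminus)

lemma ipoly_mult: "ipoly (f * g) z = ipoly f z * ipoly g z"
  by (simp add: map_poly_of_int_mult)

lemma ipoly_smult: "ipoly (smult c f) z = of_int c * ipoly f z"
  by (simp add: map_poly_of_int_smult)

lemma ipoly_power: "ipoly (f ^ k) z = ipoly f z ^ k"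
  by (induction k) (simp_all add: ipoly_mult)

lemma ipoly_const: "ipoly [:c:] z = of_int c"
  by (simp add: map_poly_pCons)

lemma ipoly_monom: "ipoly (monom c k) z = of_int c * z ^ k"
  by (simp add: map_poly_monom poly_monom)

lemma ipoly_pCons: "ipoly (pCons c f) z = of_int c + z * ipoly f z"
  by (simp add: map_poly_pCons)

lemma ipoly_pcompose: "ipoly (pcompose f g) z = ipoly f (ipoly g z)"
  by (induction f) (simp_all add: pcompose_pCons ipoly_add ipoly_mult ipoly_pCons ipoly_const)

lemmas ipoly_simps =
  ipoly_add ipoly_uminus ipoly_diff ipoly_mult ipoly_smult ipoly_power ipoly_const ipoly_monom
  ipoly_pCons ipoly_pcompose

text \<open>The inner binomial coefficients are multiples of p. The ring is arbitrary because the
  fact is applied to integers and to integer polynomials.\<close>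

lemma prime_dvd_add_power_diff:
  fixes x y :: "'a :: comm_ring_1"
  assumes "prime p"
  shows "of_nat p dvd (x + y) ^ p - (x ^ p + y ^ p)"
proof -
  have p: "p > 0" using assms by (simp add: prime_gt_0_nat)
  have "(x + y) ^ p = (\<Sum>k\<le>p. of_nat (p choose k) * x ^ k * y ^ (p - k))"
    by (rule binomial_ring)
  also have "\<dots> = (\<Sum>k\<in>{0,p} \<union> {0<..<p}. of_nat (p choose k) * x ^ k * y ^ (p - k))"
    by (rule sum.cong) auto
  also have "\<dots> = (\<Sum>k\<in>{0,p}. of_nat (p choose k) * x ^ k * y ^ (p - k))
      + (\<Sum>k\<in>{0<..<p}. of_nat (p choose k) * x ^ k * y ^ (p - k))"
    by (rule sum.union_disjoint) auto
  also have "(\<Sum>k\<in>{0,p}. of_nat (p choose k) * x ^ k * y ^ (p - k)) = x ^ p + y ^ p"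
    using p by simp
  finally have "(x + y) ^ p - (x ^ p + y ^ p)
      = (\<Sum>k\<in>{0<..<p}. of_nat (p choose k) * x ^ k * y ^ (p - k))" by simp
  also have "of_nat p dvd \<dots>"
  proof (rule dvd_sum)
    fix k assume "k \<in> {0<..<p}"
    then have "p dvd p choose k" using assms by (intro dvd_choose_prime) auto
    then have "(of_nat p :: 'a) dvd of_nat (p choose k)" by (auto simp: dvd_def)
    then show "(of_nat p :: 'a) dvd of_nat (p choose k) * x ^ k * y ^ (p - k)"
      by (simp add: dvd_mult2)
  qed
  finally show ?thesis .
qed

lemma prime_dvd_power_diff_int:
  assumes "prime p"
  shows "int p dvd c ^ p - c"
proof (induction c rule: int_induct[where k = 0])
  case base
  then show ?case using prime_gt_0_nat[OF assms] by (simp add: zero_power)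
next
  case (step1 c)
  have "int p dvd ((c + 1) ^ p - (c ^ p + 1 ^ p)) + (c ^ p - c)"
    using prime_dvd_add_power_diff[OF assms, of c 1] step1 by (intro dvd_add) simp_all
  then show ?case by (simp add: algebra_simps)
next
  case (step2 c)
  have "int p dvd c ^ p - ((c - 1) ^ p + 1)"
    using prime_dvd_add_power_diff[OF assms, of "c - 1" 1] by simp
  from dvd_diff[OF step2.IH this] show ?case by (simp add: algebra_simps)
qed

text \<open>Modulo p the p-th power is additive, fixes integers by Fermat and sends x to x^p. It
  relates f(z^p) to f(z)^p up to a multiple of p in Z[z].\<close>

lemma frobenius_int_poly:
  assumes "prime p"
  shows "of_nat p dvd f ^ p - pcompose f (monom 1 p :: int poly)"
proof (induction f)
  case 0
  then show ?case using prime_gt_0_nat[OF assms] by (simp add: zero_power)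
next
  case (pCons c f)
  let ?X = "[:0, 1:] :: int poly"
  have eq: "pCons c f = [:c:] + ?X * f" by simp
  have "of_nat p dvd ([:c:] + ?X * f) ^ p - ([:c:] ^ p + (?X * f) ^ p)"
    by (rule prime_dvd_add_power_diff[OF assms])
  moreover have "of_nat p dvd [:c ^ p - c:]"
  proof -
    obtain d where "c ^ p - c = int p * d"
      using prime_dvd_power_diff_int[OF assms, of c] by (auto simp: dvd_def)
    then have "[:c ^ p - c:] = of_nat p * [:d:]" by (simp add: of_nat_poly)
    then show ?thesis by (metis dvd_triv_left)
  qed
  moreover have "of_nat p dvd ?X ^ p * (f ^ p - pcompose f (monom 1 p))"
    by (rule dvd_mult[OF pCons.IH])
  ultimately have "of_nat p dvd ([:c:] + ?X * f) ^ p - ([:c:] ^ p + (?X * f) ^ p)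
      + [:c ^ p - c:] + ?X ^ p * (f ^ p - pcompose f (monom 1 p))"
    by (intro dvd_add)
  also have "\<dots> = (pCons c f) ^ p - pcompose (pCons c f) (monom 1 p)"
  proof -
    have "[:c ^ p - c:] = [:c:] ^ p - [:c:]" by (simp add: poly_const_pow)
    moreover have "pcompose (pCons c f) (monom 1 p) = [:c:] + ?X ^ p * pcompose f (monom 1 p)"
      by (simp add: pcompose_pCons monom_altdef)
    ultimately show ?thesis unfolding eq power_mult_distrib by (simp only: algebra_simps)
  qed
  finally show ?case .
qed

section \<open>Minimal polynomials of roots of unity over the integers\<close>

lemma monic_division:
  fixes f g :: "int poly"
  assumes "lead_coeff g = 1"
  obtains q r where "f = g * q + r" and "r = 0 \<or> degree r < degree g"
proof -
  have g: "g \<noteq> 0" using assms by auto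
  obtain q r where qr: "pseudo_divmod f g = (q, r)" by (cases "pseudo_divmod f g")
  \<comment> \<open>Pseudo-division scales f by a power of the leading coefficient, here 1, so it is
    division without denominators.\<close>
  from pseudo_divmod[OF g qr] show ?thesis using assms that by auto
qed

text \<open>The primitive part of a nonzero integer polynomial of least degree vanishing at z
  divides all others over the integers by Gauss's lemma. Dividing x^n - 1, it is monic up to
  sign.\<close>

lemma root_of_unity_minimal_polynomial:
  fixes z :: complex
  assumes "z ^ n = 1" and "n > 0"
  obtains g :: "int poly" where "lead_coeff g = 1" and "\<And>f. ipoly f z = 0 \<longleftrightarrow> g dvd f"
proof -
  define P where "P f \<longleftrightarrow> f \<noteq> 0 \<and> ipoly f z = 0" for f :: "int poly"
  let ?U = "monom 1 n - 1 :: int poly"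
  have U: "degree ?U = n" "lead_coeff ?U = 1"
  proof -
    show "degree ?U = n"
    proof (rule antisym)
      show "degree ?U \<le> n" by (intro degree_diff_le) (simp_all add: degree_monom_le)
      show "n \<le> degree ?U" using assms(2) by (intro le_degree) simp
    qed
    then show "lead_coeff ?U = 1" using assms(2) by (simp add: coeff_monom)
  qed
  have PU: "P ?U"
  proof -
    have "?U \<noteq> 0" using U(1) assms(2) by (metis degree_0 less_irrefl)
    moreover have "ipoly ?U z = 0"
      using assms(1) by (simp add: ipoly_diff ipoly_monom)
    ultimately show ?thesis by (simp add: P_def)
  qed
  obtain f0 where f0: "P f0" and min: "\<And>f. P f \<Longrightarrow> degree f0 \<le> degree f"
    using ex_has_least_nat[of P ?U degree, OF PU] by blast
  define h where "h = primitive_part f0"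
  have h0: "h \<noteq> 0" and ch: "content h = 1" and dh: "degree h = degree f0"
    using f0 by (auto simp: h_def P_def)
  have hz: "ipoly h z = 0"
  proof -
    have "of_int (content f0) * ipoly h z = ipoly f0 z"
      by (metis content_times_primitive_part h_def ipoly_smult)
    moreover have "content f0 \<noteq> 0" using f0 by (simp add: P_def)
    ultimately show ?thesis using f0 by (simp add: P_def)
  qed
  have dvd: "h dvd f" if fz: "ipoly f z = 0" for f
  proof -
    obtain a q r where a: "a \<noteq> 0" and eq: "smult a f = h * q + r"
      and r: "r = 0 \<or> degree r < degree h"
      using pseudo_mod[OF h0, of f] by blast
    have "ipoly r z = 0"
    proof -
      have "r = smult a f - h * q" using eq by simp
      then show ?thesis using fz hz by (simp add: ipoly_simps)
    qed
    then have "r = 0" using r min[of r] dh unfolding P_def by (metis not_le)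
    then have eq: "smult a f = h * q" using eq by simp
    \<comment> \<open>As h is primitive, the scaling factor a of the pseudo-division divides the
      content of q and can be cancelled.\<close>
    then have "normalize a * content f = content q"
      using ch by (metis content_mult content_smult mult_1)
    then have "a dvd content q" by (metis dvd_triv_left normalize_dvd_iff)
    then have "[:a:] dvd q" by (simp add: const_poly_dvd_iff_dvd_content)
    then obtain q' where "q = smult a q'" by (auto simp: dvd_def)
    then have "smult a f = smult a (h * q')" using eq by simp
    then have "f = h * q'" using a by (metis smult_cancel)
    then show ?thesis by simp
  qed
  obtain k where k: "?U = h * k" using dvd[of ?U] PU by (auto simp: P_def dvd_def)
  \<comment> \<open>Both leading coefficients are integer units, so multiplying h by its own leading
    coefficient makes it monic.\<close>
  have lc: "lead_coeff h * lead_coeff k = 1" using U(2) k by (metis lead_coeff_mult)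
  then have "lead_coeff h * lead_coeff h = 1"
    by (auto simp: zmult_eq_1_iff)
  then have "lead_coeff (smult (lead_coeff h) h) = 1" by (simp only: lead_coeff_smult)
  moreover have "ipoly f z = 0 \<longleftrightarrow> smult (lead_coeff h) h dvd f" for f
  proof -
    let ?c = "lead_coeff h"
    have c: "?c * ?c = 1" using \<open>lead_coeff h * lead_coeff h = 1\<close> .
    have "smult ?c h dvd f \<longleftrightarrow> h dvd f"
    proof
      assume "h dvd f"
      then obtain k where "f = h * k" by (auto simp: dvd_def)
      then have "f = smult ?c h * smult ?c k"
        using c by (simp only: mult_smult_left mult_smult_right smult_smult smult_1_left)
      then show "smult ?c h dvd f" by (metis dvd_triv_left)
    next
      assume "smult ?c h dvd f"
      then obtain k where "f = smult ?c h * k" by (auto simp only: dvd_def)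
      then have "f = h * smult ?c k" by (simp only: mult_smult_left mult_smult_right)
      then show "h dvd f" by (metis dvd_triv_left)
    qed
    moreover have "h dvd f \<Longrightarrow> ipoly f z = 0" using hz by (auto simp: ipoly_mult)
    ultimately show ?thesis using dvd by blast
  qed
  ultimately show ?thesis using that by blast
qed

text \<open>A rational number in Z[z] is an integer: the minimal polynomial being monic, Z[z] has
  the integral basis of the powers of z below its degree, and 1 is one of them. Divisibility in Z[z]
  between integers thus descends to the integers.\<close>

lemma rational_in_Z_adjoin_root_of_unity:
  fixes z :: complex
  assumes "z ^ n = 1" and "n > 0" and "of_int v * ipoly f z = of_int u"
  shows "v dvd u"
proof (cases "v = 0")
  case False
  obtain g where g: "lead_coeff g = 1" "\<And>f. ipoly f z = 0 \<longleftrightarrow> g dvd f"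
    using root_of_unity_minimal_polynomial[OF assms(1,2)] by blast
  obtain q r where qr: "f = g * q + r" "r = 0 \<or> degree r < degree g"
    using monic_division[OF g(1)] by blast
  have gz: "ipoly g z = 0" using g(2) by simp
  have g0: "degree g > 0"
  proof (rule ccontr)
    assume "\<not> degree g > 0"
    then obtain c where "g = [:c:]" using degree_eq_zeroE by blast
    with g(1) gz show False by (simp add: ipoly_const)
  qed
  have "ipoly f z = ipoly r z" using qr(1) gz by (simp add: ipoly_simps)
  then have "ipoly (smult v r - [:u:]) z = 0" using assms(3) by (simp add: ipoly_simps)
  then have "g dvd smult v r - [:u:]" using g(2) by blast
  moreover have "degree (smult v r - [:u:]) < degree g"
    using qr(2) g0 False by (intro degree_diff_less) auto
  ultimately have "smult v r - [:u:] = 0" by (metis dvd_imp_degree_le not_le)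
  then have "smult v r = [:u:]" by simp
  then have "v * coeff r 0 = u" by (metis coeff_pCons_0 coeff_smult)
  then show ?thesis by auto
qed (use assms in simp)

text \<open>
  If \<open>g\<close> is the minimal polynomial of \<open>z\<close> and \<open>x\<^sup>n - 1 = g * h\<close>, then \<open>g(z\<^sup>p)\<close> is divisible by \<open>p\<close> because
  of Frobenius. If \<open>g(z\<^sup>p) \<noteq> 0\<close>, then \<open>h(z\<^sup>p) = 0\<close>, and the derivative of \<open>x\<^sup>n - 1\<close> at \<open>z\<^sup>p\<close> shows that \<open>p\<close>
  divides \<open>n\<close>.
\<close>

lemma ipoly_prime_power_root:
  fixes z :: complex
  assumes "z ^ n = 1" and "n > 0" and "prime p" and "\<not> p dvd n" and "ipoly f z = 0"
  shows "ipoly f (z ^ p) = 0"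
proof -
  obtain g where g: "\<And>f. ipoly f z = 0 \<longleftrightarrow> g dvd f"
    using root_of_unity_minimal_polynomial[OF assms(1,2)] by blast
  have gz: "ipoly g z = 0" using g by simp
  have "ipoly (monom 1 n - 1) z = 0" using assms(1) by (simp add: ipoly_diff ipoly_monom)
  then obtain h where h: "monom 1 n - 1 = g * h" using g by (auto simp: dvd_def)
  obtain u where u: "g ^ p - pcompose g (monom 1 p) = of_nat p * u"
    using frobenius_int_poly[OF assms(3), of g] by (auto simp: dvd_def)
  let ?w = "z ^ p"
  have w: "?w ^ n = 1" using assms(1) by (metis power_commutes power_mult mult.commute power_one)
  have gw: "ipoly g ?w = - (of_nat p * ipoly u z)"
  proof -
    have "ipoly (g ^ p - pcompose g (monom 1 p)) z = ipoly (smult (int p) u) z"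
      using u by (simp add: of_nat_poly)
    then show ?thesis using gz prime_gt_0_nat[OF assms(3)]
      by (simp add: ipoly_simps zero_power) (metis minus_minus)
  qed
  have "ipoly g ?w = 0"
  proof (rule ccontr)
    assume "ipoly g ?w \<noteq> 0"
    moreover have "ipoly g ?w * ipoly h ?w = 0"
      using w arg_cong[OF h, of "\<lambda>f. ipoly f ?w"] by (simp add: ipoly_simps)
    ultimately have hw: "ipoly h ?w = 0" by simp
    \<comment> \<open>The derivative of x^n - 1 = g h at w is g(w) h'(w), because h(w) = 0.
      Multiplying by w turns the left side n w^(n-1) into n, which is therefore a multiple of g(w),
      hence of p, in Z[z].\<close>
    have "monom (int n) (n - 1) = g * pderiv h + h * pderiv g"
      using arg_cong[OF h, of pderiv] by (simp add: pderiv_mult pderiv_diff pderiv_monom)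
    from arg_cong[OF this, of "\<lambda>f. ipoly f ?w"] hw
    have "of_nat n * ?w ^ (n - 1) = ipoly g ?w * ipoly (pderiv h) ?w"
      by (simp add: ipoly_simps)
    then have "of_nat n * ?w ^ (n - 1) * ?w = ipoly g ?w * ipoly (pderiv h) ?w * ?w" by (simp only:)
    moreover have "?w ^ (n - 1) * ?w = 1" using w assms(2)
      by (metis Suc_diff_1 power_Suc2)
    ultimately have "of_nat n = ipoly g ?w * ipoly (pderiv h) ?w * ?w"
      by (simp only: mult.assoc mult_1_right)
    then have "of_int (int p) *
        ipoly (- (u * pcompose (pderiv h) (monom 1 p) * monom 1 p)) z = of_int (int n)"
      by (simp add: ipoly_simps gw mult.assoc)
    then have "int p dvd int n"
      by (rule rational_in_Z_adjoin_root_of_unity[OF assms(1,2)])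
    then show False using assms(4) by simp
  qed
  moreover have "g dvd f" using g assms(5) by blast
  ultimately show ?thesis by (auto simp: ipoly_mult)
qed

text \<open>The prime factors of j are applied one at a time, each to the n-th root of unity reached
  so far. This plays the part of the Galois action on the n-th cyclotomic field.\<close>

lemma ipoly_coprime_power_root:
  fixes z :: complex
  assumes "z ^ n = 1" and "n > 0" and "coprime j n" and "ipoly f z = 0"
  shows "ipoly f (z ^ j) = 0"
  using assms
proof (induction j arbitrary: z rule: prime_divisors_induct)
  case zero
  then show ?case by simp
next
  case (unit j)
  then show ?case by simp
next
  case (factor p j)
  have "\<not> p dvd n"
    using factor by (meson coprime_common_divisor dvd_triv_left not_prime_unit)
  then have "ipoly f (z ^ p) = 0" using factor by (intro ipoly_prime_power_root[of z n p f]) auto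
  moreover have "(z ^ p) ^ n = 1" using factor by (metis power_mult mult.commute power_one)
  ultimately have "ipoly f ((z ^ p) ^ j) = 0" using factor by (intro factor.IH) auto
  then show ?case by (simp add: power_mult)
qed

section \<open>The conjugates of a primitive root of unity\<close>

lemma primitive_root_powers:
  fixes z :: complex
  assumes prim: "\<And>k. z ^ k = 1 \<longleftrightarrow> n dvd k" and n: "n > 0"
  shows "inj_on (\<lambda>j. z ^ j) {0<..n}" and "(\<lambda>j. z ^ j) ` {0<..n} = {w. w ^ n = 1}"
proof -
  have z0: "z \<noteq> 0" using prim[of n] n by (auto simp: zero_power)
  show inj: "inj_on (\<lambda>j. z ^ j) {0<..n}"
  proof (rule linorder_inj_onI)
    fix i j assume ij: "i < j" "i \<in> {0<..n}" "j \<in> {0<..n}"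
    show "z ^ i \<noteq> z ^ j"
    proof
      assume "z ^ i = z ^ j"
      also have "z ^ j = z ^ i * z ^ (j - i)" using ij by (simp flip: power_add)
      finally have "z ^ (j - i) = 1" using z0 by simp
      then have "n dvd j - i" using prim by simp
      then show False using ij by (auto dest: dvd_imp_le)
    qed
  qed auto
  have sub: "(\<lambda>j. z ^ j) ` {0<..n} \<subseteq> {w. w ^ n = 1}"
  proof (intro subsetI)
    fix w assume "w \<in> (\<lambda>j. z ^ j) ` {0<..n}"
    then obtain j where "w = z ^ j" by blast
    then have "w ^ n = z ^ (j * n)" by (simp add: power_mult)
    then show "w \<in> {w. w ^ n = 1}" using prim[of "j * n"] by simp
  qed
  have fin: "finite {w :: complex. w ^ n = 1}"
    using n by (intro finite_roots_unity) simp
  have "card {w :: complex. w ^ n = 1} \<le> card ((\<lambda>j. z ^ j) ` {0<..n})"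
    using n by (simp add: card_image[OF inj] card_roots_unity)
  with card_seteq[OF fin sub] show "(\<lambda>j. z ^ j) ` {0<..n} = {w. w ^ n = 1}" by blast
qed

text \<open>Since x^n - 1 = g h has n distinct roots, g has as many roots as its degree. They
  include all z^j with j prime to n by conjugation, and no others because a root of smaller order
  would force that order on z.\<close>

lemma degree_cyclotomic:
  fixes z :: complex and g :: "int poly"
  assumes prim: "\<And>k. z ^ k = 1 \<longleftrightarrow> n dvd k" and n: "n > 0"
    and lc: "lead_coeff g = 1" and g: "\<And>f. ipoly f z = 0 \<longleftrightarrow> g dvd f"
  shows "degree g = totient n"
proof -
  let ?U = "\<lambda>k. monom 1 k - 1 :: int poly"
  let ?R = "\<lambda>f. {w. ipoly f w = 0}"
  have ipU: "ipoly (?U k) w = w ^ k - 1" for k w by (simp add: ipoly_diff ipoly_monom)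
  have zn: "z ^ n = 1" using prim by simp
  obtain h where h: "?U n = g * h" using g[of "?U n"] zn ipU[of n z] by (auto simp: dvd_def)
  have roots_U: "?R (?U n) = {w. w ^ n = 1}" using ipU by auto
  have deg: "degree (map_poly of_int f :: complex poly) = degree f" for f :: "int poly"
    by (simp add: degree_map_poly)
  have cardle: "card (?R f) \<le> degree f \<and> finite (?R f)" if "f \<noteq> 0" for f
  proof -
    have "map_poly of_int f \<noteq> (0 :: complex poly)" using that by (simp add: map_poly_eq_0_iff)
    from card_poly_roots_bound[OF this] poly_roots_finite[OF this] show ?thesis
      by (simp add: deg)
  qed
  have U0: "?U n \<noteq> 0"
  proof
    assume U: "?U n = 0"
    have "ipoly (?U n) 0 = -1" using n by (simp only: ipU) (simp add: zero_power)
    then show False by (simp only: U) simp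
  qed
  then have gh0: "g \<noteq> 0" "h \<noteq> 0" using h by auto
  have "degree g + degree h = degree (?U n)" using h gh0 degree_mult_eq[of g h] by simp
  also have "\<dots> \<le> n" by (intro degree_diff_le) (simp_all add: degree_monom_le)
  finally have "degree g + degree h \<le> n" .
  moreover have "n \<le> card (?R g) + card (?R h)"
  proof -
    have "n = card (?R (?U n))"
      unfolding roots_U primitive_root_powers(2)[OF prim n, symmetric]
      using card_image[OF primitive_root_powers(1)[OF prim n]] by simp
    also have "?R (?U n) = ?R g \<union> ?R h" unfolding h by (auto simp: ipoly_mult)
    also have "card \<dots> \<le> card (?R g) + card (?R h)" by (rule card_Un_le)
    finally show ?thesis .
  qed
  \<comment> \<open>The root counts of g and h are at most their degrees, yet their sum is at least
    n and the degrees add up to at most n, so equality holds throughout.\<close>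
  ultimately have "degree g = card (?R g)" using cardle[OF gh0(1)] cardle[OF gh0(2)] by linarith
  also have "?R g = (\<lambda>j. z ^ j) ` totatives n"
  proof (intro equalityI subsetI)
    fix w assume "w \<in> (\<lambda>j. z ^ j) ` totatives n"
    then obtain j where "coprime j n" "w = z ^ j" by (auto simp: totatives_def)
    then show "w \<in> ?R g" using ipoly_coprime_power_root[OF zn n, of j g] g by simp
  next
    fix w assume w: "w \<in> ?R g"
    then have "w \<in> ?R (?U n)" unfolding h by (simp add: ipoly_mult)
    then obtain j where j: "j \<in> {0<..n}" "w = z ^ j"
      unfolding roots_U primitive_root_powers(2)[OF prim n, symmetric] by auto
    \<comment> \<open>The order of w = z^j divides n / e. If the minimal polynomial g' of w, a
      factor of g, did not vanish at z, then g would divide the cofactor q, which is too small. So z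
      also has order dividing n / e, and e = 1.\<close>
    let ?e = "gcd j n"
    have ne: "n div ?e > 0" using n by (simp add: div_greater_zero_iff gcd_le2_nat)
    have we: "w ^ (n div ?e) = 1"
    proof -
      have "j * (n div ?e) = n * (j div ?e)"
        by (metis div_mult_swap dvd_div_mult gcd_dvd1 gcd_dvd2 mult.commute)
      then show ?thesis using j prim by (simp flip: power_mult)
    qed
    obtain g' where g': "lead_coeff g' = 1" "\<And>f. ipoly f w = 0 \<longleftrightarrow> g' dvd f"
      using root_of_unity_minimal_polynomial[OF we ne] by blast
    obtain q where q: "g = g' * q" using g'(2) w by (auto simp: dvd_def)
    have "ipoly g z = 0" using g by simp
    then have "ipoly g' z = 0 \<or> ipoly q z = 0" using q by (simp add: ipoly_mult)
    moreover have False if "ipoly q z = 0"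
    proof -
      have q0: "q \<noteq> 0" "g' \<noteq> 0" using q gh0 by auto
      have "g dvd q" using that g by simp
      then have "degree g \<le> degree q" using q0 by (intro dvd_imp_degree_le) auto
      then have "degree g' = 0" using q q0 by (simp add: degree_mult_eq)
      then obtain c where "g' = [:c:]" using degree_eq_zeroE by blast
      with g' show False by (metis dvd_refl ipoly_const lead_coeff_pCons(2) of_int_1 zero_neq_one)
    qed
    ultimately have "ipoly g' z = 0" by blast
    moreover have "g' dvd ?U (n div ?e)" using g'(2) ipU we by (metis diff_self)
    ultimately have "ipoly (?U (n div ?e)) z = 0" by (auto simp: ipoly_mult)
    then have "n dvd n div ?e" using ipU prim by simp
    then have "n \<le> n div ?e" using ne by (auto dest: dvd_imp_le)
    then have "?e = 1" using n
      by (metis div_less_dividend gcd_eq_0_iff less_one linorder_neqE_nat not_le neq0_conv)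
    then have "j \<in> totatives n"
      using j(1) by (metis (no_types, lifting) coprime_iff_gcd_eq_1 greaterThanAtMost_iff in_totatives_iff)
    then show "w \<in> (\<lambda>j. z ^ j) ` totatives n" using j(2) by blast
  qed
  also have "card \<dots> = card (totatives n)"
    by (rule card_image, rule inj_on_subset[OF primitive_root_powers(1)[OF prim n]])
      (auto simp: totatives_def)
  finally show ?thesis by (simp add: totient_def)
qed

text \<open>The remainder r of f modulo the minimal polynomial has degree below
  \<open>totient n\<close> and takes the same value at the \<open>totient n\<close> conjugates of z,
  so it is constant.\<close>

lemma galois_invariant_imp_integer:
  fixes z :: complex and f :: "int poly"
  assumes prim: "\<And>k. z ^ k = 1 \<longleftrightarrow> n dvd k" and n: "n > 0"
    and inv: "\<And>j. coprime j n \<Longrightarrow> ipoly f (z ^ j) = ipoly f z"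
  shows "ipoly f z \<in> \<int>"
proof -
  have zn: "z ^ n = 1" using prim by simp
  obtain g where g: "lead_coeff g = 1" "\<And>f. ipoly f z = 0 \<longleftrightarrow> g dvd f"
    using root_of_unity_minimal_polynomial[OF zn n] by blast
  have dg: "degree g = totient n" by (rule degree_cyclotomic[OF prim n g])
  obtain q r where qr: "f = g * q + r" "r = 0 \<or> degree r < degree g"
    using monic_division[OF g(1)] by blast
  let ?p = "map_poly of_int r - [:ipoly f z:] :: complex poly"
  have root: "poly ?p (z ^ j) = 0" if "coprime j n" for j
  proof -
    have "ipoly g z = 0" using g(2)[of g] by simp
    then have "ipoly g (z ^ j) = 0" by (rule ipoly_coprime_power_root[OF zn n that])
    then have "ipoly f (z ^ j) = ipoly r (z ^ j)" by (subst qr(1)) (simp add: ipoly_simps)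
    then show ?thesis using inv[OF that] by simp
  qed
  have "?p = 0"
  proof (rule ccontr)
    assume p0: "?p \<noteq> 0"
    have "totient n = card ((\<lambda>j. z ^ j) ` totatives n)"
      unfolding totient_def
      by (rule card_image[symmetric], rule inj_on_subset[OF primitive_root_powers(1)[OF prim n]])
        (auto simp: totatives_def)
    also have "\<dots> \<le> card {x. poly ?p x = 0}"
      using root by (intro card_mono poly_roots_finite p0) (auto simp: totatives_def)
    also have "\<dots> \<le> degree ?p" by (rule card_poly_roots_bound[OF p0])
    finally have "totient n \<le> degree ?p" .
    moreover have "degree ?p < totient n"
      using qr(2) dg n by (intro degree_diff_less) (auto simp: degree_map_poly)
    ultimately show False by simp
  qed
  then have "coeff ?p 0 = 0" by (simp only: coeff_0)
  then have "ipoly f z = of_int (coeff r 0)" by (simp add: coeff_map_poly)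
  then show ?thesis by simp
qed

section \<open>Square roots in cyclotomic fields\<close>

text \<open>The ring Q[z] with one common denominator, so that statements about its elements become
  statements about integer polynomials. For a root of unity z it is the cyclotomic field.\<close>

definition Qadj :: "complex \<Rightarrow> complex set" where
  "Qadj z = {ipoly f z / of_nat M | f M. M > 0}"

lemma ipoly_in_Qadj: "ipoly f z \<in> Qadj z"
  unfolding Qadj_def by (rule CollectI, rule exI[of _ f], rule exI[of _ 1]) simp

lemma Qadj_mult: "x \<in> Qadj z \<Longrightarrow> y \<in> Qadj z \<Longrightarrow> x * y \<in> Qadj z"
proof -
  assume "x \<in> Qadj z" "y \<in> Qadj z"
  then obtain f M g N where "x = ipoly f z / of_nat M" "M > 0" "y = ipoly g z / of_nat N" "N > 0"
    unfolding Qadj_def by blast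
  then have "x * y = ipoly (f * g) z / of_nat (M * N)" "M * N > 0"
    by (simp_all add: ipoly_mult)
  then show ?thesis unfolding Qadj_def by blast
qed

lemma Qadj_div_nat: "x \<in> Qadj z \<Longrightarrow> M > 0 \<Longrightarrow> x / of_nat M \<in> Qadj z"
proof -
  assume "x \<in> Qadj z" "M > 0"
  then obtain f N where "x = ipoly f z / of_nat N" "N > 0" unfolding Qadj_def by blast
  then have "x / of_nat M = ipoly f z / of_nat (M * N)" "M * N > 0" using \<open>M > 0\<close> by simp_all
  then show ?thesis unfolding Qadj_def by blast
qed

text \<open>
  Descent on the denominator \<open>M\<close> of \<open>x\<close>: for \<open>p\<close> not dividing \<open>n\<close>, Frobenius maps \<open>M x\<close> to \<open>\<plusminus>M x\<close>, and this
  is congruent to \<open>(M x)\<^sup>p\<close>, which \<open>p\<close> divides; hence \<open>p\<close> divides \<open>M x\<close>, and then \<open>M\<close> as \<open>a\<close> is squarefree.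
\<close>

lemma sqrt_in_cyclotomic_imp_dvd:
  assumes zn: "z ^ n = 1" "n > 0" and x: "x \<in> Qadj z" "x ^ 2 = of_nat a"
    and a: "squarefree a" and p: "prime p" "p dvd a"
  shows "p dvd n"
proof (rule ccontr)
  assume pn: "\<not> p dvd n"
  have "False" if "x * of_nat M = ipoly f z" "M > 0" for f M
    using that
  proof (induction M arbitrary: f rule: less_induct)
    case (less M)
    have fz2: "ipoly f z ^ 2 = of_nat (M ^ 2 * a)"
      using x(2) less.prems(1) by (metis mult.commute of_nat_mult of_nat_power power_mult_distrib)
    obtain b where b: "a = p * b" using p by (auto simp: dvd_def)
    obtain u where u: "f ^ p - pcompose f (monom 1 p) = of_nat p * u"
      using frobenius_int_poly[OF p(1), of f] by (auto simp: dvd_def)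
    have "ipoly (f ^ p - pcompose f (monom 1 p)) z = ipoly (smult (int p) u) z"
      using u by (simp add: of_nat_poly)
    then have fr: "ipoly f (z ^ p) = ipoly f z ^ p - of_nat p * ipoly u z"
      by (simp add: ipoly_simps algebra_simps)
    \<comment> \<open>Splitting off two factors exposes f(z)^2 = M^2 a inside f(z)^p, and a supplies
      the factor p.\<close>
    obtain p' where p': "p = p' + 2" using prime_ge_2_nat[OF p(1)] by (metis add.commute le_Suc_ex)
    have "ipoly f z ^ p = ipoly f z ^ p' * of_nat (M ^ 2 * a)"
      unfolding p' power_add fz2 ..
    with fr have fr': "ipoly f (z ^ p)
        = of_nat p * ipoly (f ^ p' * [:int (M ^ 2 * b):] - u) z"
      by (simp add: b ipoly_simps algebra_simps)
    have "ipoly (f ^ 2 - [:int (M ^ 2 * a):]) z = 0" using fz2 by (simp add: ipoly_simps)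
    from ipoly_prime_power_root[OF zn p(1) pn this]
    have "ipoly f (z ^ p) ^ 2 = ipoly f z ^ 2" using fz2 by (simp add: ipoly_simps)
    then have "ipoly f z = ipoly f (z ^ p) \<or> ipoly f z = - ipoly f (z ^ p)"
      by (metis power2_eq_iff)
    then obtain w where w: "ipoly f z = of_nat p * ipoly w z"
      using fr' by (metis ipoly_uminus mult_minus_right)
    have "of_int (int p ^ 2) * ipoly (w ^ 2) z = of_int (int (M ^ 2 * a))"
      using fz2 by (simp add: w ipoly_simps power_mult_distrib)
    then have "int p ^ 2 dvd int (M ^ 2 * a)" by (rule rational_in_Z_adjoin_root_of_unity[OF zn])
    then have "p ^ 2 dvd M ^ 2 * a" by (metis of_nat_dvd_iff of_nat_power)
    have "p dvd M"
    proof (rule ccontr)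
      assume "\<not> p dvd M"
      then have "coprime (p ^ 2) (M ^ 2)" using p(1) by (simp add: prime_imp_coprime)
      then have "p ^ 2 dvd a" using \<open>p ^ 2 dvd M ^ 2 * a\<close> by (simp add: coprime_dvd_mult_right_iff)
      then show False using a p(1) by (auto simp: squarefree_def)
    qed
    then obtain M' where M': "M = p * M'" by (auto simp: dvd_def)
    have "x * of_nat M' = ipoly w z"
      using less.prems(1) w prime_gt_0_nat[OF p(1)] by (simp add: M')
    moreover have "M' > 0" "M' < M"
      using M' less.prems(2) prime_gt_1_nat[OF p(1)] by auto
    ultimately show False using less.IH by blast
  qed
  moreover obtain f M where "x = ipoly f z / of_nat M" "M > 0" using x(1) unfolding Qadj_def by blast
  then have "x * of_nat M = ipoly f z" "M > 0" by simp_all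
  ultimately show False by blast
qed

text \<open>Being real is itself an algebraic relation: complex conjugation sends z to z^(n-1), so a
  real f(z) satisfies f(z^(n-1)) = f(z). This relation and the rationality of the N-th power both
  carry over to z^j, so f(z^j)^2 is independent of j.\<close>

lemma real_radical_in_cyclotomic:
  assumes prim: "\<And>k. z ^ k = 1 \<longleftrightarrow> n dvd k" and n: "n > 0"
    and x: "x \<in> Qadj z" "x \<in> \<real>" and N: "x ^ N \<in> \<rat>" "N > 0"
  shows "x ^ 2 \<in> \<rat>"
proof -
  have zn: "z ^ n = 1" using prim by simp
  obtain f M where fM: "x = ipoly f z / of_nat M" "M > 0" using x(1) unfolding Qadj_def by blast
  define y where "y = ipoly f z"
  have xy: "y = x * of_nat M" using fM by (simp add: y_def)
  have yr: "y \<in> \<real>" unfolding xy using x(2) by (intro Reals_mult) auto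
  have "y ^ N \<in> \<rat>" unfolding xy power_mult_distrib using N by (intro Rats_mult) auto
  then obtain v u :: int where uv: "v \<noteq> 0" "of_int v * y ^ N = of_int u"
  proof -
    assume "y ^ N \<in> \<rat>"
    then obtain q where q: "y ^ N = of_rat q" by (rule Rats_cases)
    obtain u v where "quotient_of q = (u, v)" by (cases "quotient_of q")
    then have "v > 0" "q = of_int u / of_int v"
      by (simp_all add: quotient_of_denom_pos quotient_of_div)
    then show ?thesis using that[of v u] q by (simp add: of_rat_divide)
  qed
  have cz: "cnj w = w ^ (n - 1)" if "w ^ n = 1" for w :: complex
  proof -
    have "norm w ^ n = 1" using that by (metis norm_one norm_power)
    then have "norm w = 1" using n by (metis norm_ge_zero power_eq_imp_eq_base power_one zero_le_one)
    then have "w * cnj w = 1" by (metis complex_norm_square of_real_1 power_one)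
    moreover have "w * w ^ (n - 1) = 1" using that n by (metis Suc_diff_1 power_Suc)
    moreover have "w \<noteq> 0" using that n by (auto simp: zero_power)
    ultimately show ?thesis by (metis mult_cancel_left)
  qed
  have cnj_ipoly: "cnj (ipoly f w) = ipoly f (cnj w)" for w
    by (induction f) (simp_all add: ipoly_pCons)
  have "ipoly f (z ^ j) ^ 2 = y ^ 2" if j: "coprime j n" for j
  proof -
    let ?w = "ipoly f (z ^ j)"
    have zj: "(z ^ j) ^ n = 1" using zn by (metis mult.commute power_mult power_one)
    have "ipoly (smult v (f ^ N) - [:u:]) z = 0"
      using uv by (simp add: ipoly_simps y_def)
    from ipoly_coprime_power_root[OF zn n j this]
    have "of_int v * ?w ^ N = of_int u" by (simp add: ipoly_simps)
    then have "of_int v * ?w ^ N = of_int v * y ^ N" using uv by simp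
    then have wN: "?w ^ N = y ^ N" using uv(1) by (metis mult_cancel_left of_int_eq_0_iff)
    have "ipoly f (z ^ (n - 1)) = y"
      using cnj_ipoly[of z] cz[OF zn] yr by (simp add: y_def Reals_cnj_iff)
    then have "ipoly (pcompose f (monom 1 (n - 1)) - f) z = 0"
      by (simp add: ipoly_simps y_def)
    from ipoly_coprime_power_root[OF zn n j this]
    have "ipoly f ((z ^ j) ^ (n - 1)) = ?w" by (simp add: ipoly_simps)
    then have "?w \<in> \<real>" using cnj_ipoly[of "z ^ j"] cz[OF zj] by (simp add: Reals_cnj_iff)
    then obtain r where r: "?w = of_real r" by (auto elim: Reals_cases)
    obtain s where s: "y = of_real s" using yr by (auto elim: Reals_cases)
    have "norm ?w ^ N = norm y ^ N" using wN by (metis norm_power)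
    then have "norm ?w = norm y" using N(2) by (meson norm_ge_zero power_eq_imp_eq_base)
    then have "\<bar>r\<bar> = \<bar>s\<bar>" using r s by simp
    then have "r ^ 2 = s ^ 2" by (metis power2_abs)
    then show ?thesis using r s by (simp flip: of_real_power)
  qed
  then have "ipoly (f ^ 2) z \<in> \<int>"
    by (intro galois_invariant_imp_integer[OF prim n]) (simp add: ipoly_power y_def)
  then have "y ^ 2 \<in> \<rat>" using Ints_subset_Rats by (auto simp: ipoly_power y_def)
  moreover have "x ^ 2 = y ^ 2 / of_nat (M ^ 2)" using xy fM(2) by (simp add: power_mult_distrib)
  ultimately show ?thesis by (simp add: Rats_divide)
qed

text \<open>The square root of 2 lives in the larger field generated by z', where the conjugation z'
  to -z' fixes z'^2 but negates the primitive 8th root of unity e = z'^(n/4), as n/4 is odd. It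
  negates e - e^3, one of the square roots of 2, which then cannot lie in the field of z'^2.\<close>

lemma sqrt_2_notin_cyclotomic:
  assumes prim: "\<And>k. z' ^ k = 1 \<longleftrightarrow> 2 * n dvd k" and n: "4 dvd n" "\<not> 8 dvd n" "n > 0"
    and x: "x \<in> Qadj (z' ^ 2)"
  shows "x ^ 2 \<noteq> 2"
proof
  assume x2: "x ^ 2 = 2"
  obtain m where m: "n = 4 * m" using n(1) by (auto simp: dvd_def)
  have "odd m"
  proof
    assume "even m"
    then show False using n(2) m by (auto elim!: evenE)
  qed
  obtain f M where fM: "x = ipoly f (z' ^ 2) / of_nat M" "M > 0" using x unfolding Qadj_def by blast
  have z2n: "z' ^ (2 * n) = 1" using prim by simp
  have zn: "z' ^ n = -1"
  proof -
    have "(z' ^ n) ^ 2 = 1" using z2n by (simp add: power_mult mult.commute flip: power_mult)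
    moreover have "z' ^ n \<noteq> 1" using prim n(3) by (auto dest: dvd_imp_le)
    ultimately show ?thesis by (metis power2_eq_1_iff)
  qed
  define e where "e = z' ^ m"
  have e4: "e ^ 4 = -1" using zn by (simp add: e_def m mult.commute flip: power_mult)
  have "(e - e ^ 3) ^ 2 = e ^ 2 * (1 + e ^ 4) - 2 * e ^ 4"
    by (simp add: eval_nat_numeral algebra_simps)
  then have "(e - e ^ 3) ^ 2 = x ^ 2" using e4 x2 by simp
  then have "x = e - e ^ 3 \<or> x = - (e - e ^ 3)" by (metis power2_eq_iff)
  then obtain s :: int where s: "x = of_int s * (e - e ^ 3)" "s = 1 \<or> s = -1"
    using that[of 1] that[of "-1"] by auto
  \<comment> \<open>The assumed relation M x = f(z'^2), with x written as s (e - e^3), as an integer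
    polynomial vanishing at z'.\<close>
  let ?F = "pcompose f (monom 1 2) - smult (s * int M) (monom 1 m - monom 1 (3 * m))"
  have e3: "z' ^ (3 * m) = e ^ 3" by (simp add: e_def mult.commute flip: power_mult)
  have "ipoly ?F z' = ipoly f (z' ^ 2) - of_int s * of_nat M * (e - e ^ 3)"
    by (simp add: ipoly_simps e3) (simp add: e_def)
  also have "\<dots> = 0" using fM s(1) by (simp add: field_simps)
  finally have Fz: "ipoly ?F z' = 0" .
  \<comment> \<open>The exponent 1 + n realizes the conjugation to -z', because z'^n = -1; it is
    prime to 2n as n is even.\<close>
  have cop: "coprime (1 + n) (2 * n)"
  proof -
    have "coprime (1 + n) n" by simp
    moreover have "coprime (1 + n) 2" using m by simp
    ultimately show ?thesis by simp
  qed
  have "2 * n > 0" using n(3) by simp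
  then have "ipoly ?F (z' ^ (1 + n)) = 0" by (rule ipoly_coprime_power_root[OF z2n _ cop Fz])
  moreover have "z' ^ (1 + n) = - z'" using zn by simp
  ultimately have "ipoly ?F (- z') = 0" by (simp only:)
  moreover have "(- z') ^ m = - e" "(- z') ^ (3 * m) = - (e ^ 3)"
    using \<open>odd m\<close> e3 by (simp_all add: e_def)
  ultimately have "ipoly f (z' ^ 2) + of_int s * of_nat M * (e - e ^ 3) = 0"
    by (simp add: ipoly_simps algebra_simps)
  moreover have "ipoly f (z' ^ 2) = of_int s * of_nat M * (e - e ^ 3)"
    using fM s(1) by (simp add: field_simps)
  ultimately have "of_int s * of_nat M * (e - e ^ 3) = 0" by simp
  then have "e - e ^ 3 = 0" using s(2) fM(2) by auto
  then have "x = 0" using s by simp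
  then show False using x2 by simp
qed

text \<open>This is (x^p - 1) / (x - 1), factored on one side and expanded as a geometric sum on the
  other, evaluated at 1.\<close>

lemma prod_one_minus_roots_of_unity:
  fixes w :: complex
  assumes prim: "\<And>k. w ^ k = 1 \<longleftrightarrow> p dvd k" and p: "p > 0"
  shows "(\<Prod>j\<in>{0<..<p}. 1 - w ^ j) = of_nat p"
proof -
  let ?q = "\<Prod>j\<in>{0<..<p}. [:- (w ^ j), 1:]" and ?s = "\<Sum>i<p. monom (1 :: complex) i"
  have inj: "inj_on (\<lambda>j. w ^ j) {0<..<p}"
    by (rule inj_on_subset[OF primitive_root_powers(1)[OF prim p]]) auto
  have deg: "degree ?q = p - 1" by (subst degree_prod_eq_sum_degree) auto
  have "?q = ?s"
  proof (rule poly_eqI_degree_lead_coeff)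
    have "lead_coeff ?q = 1" by (simp add: lead_coeff_prod)
    then have "coeff ?q (p - 1) = 1" using deg by simp
    moreover have "coeff ?s (p - 1) = 1" using p by (simp add: coeff_sum)
    ultimately show "coeff ?q (p - 1) = coeff ?s (p - 1)" by simp
    show "card ((\<lambda>j. w ^ j) ` {0<..<p}) \<ge> p - 1" using card_image[OF inj] by simp
    show "degree ?q \<le> p - 1" using deg by simp
    show "degree ?s \<le> p - 1"
      by (intro degree_sum_le) (auto intro: order.trans[OF degree_monom_le])
    fix x assume "x \<in> (\<lambda>j. w ^ j) ` {0<..<p}"
    then obtain j where j: "0 < j" "j < p" "x = w ^ j" by auto
    have "poly ?q x = 0" using j by (auto simp: poly_prod)
    moreover have "poly ?s x = 0"
    proof -
      have "x \<noteq> 1" using j prim[of j] by (auto dest: dvd_imp_le)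
      moreover have "x ^ p = 1" using j prim[of "j * p"] by (simp add: power_mult)
      moreover have "(1 - x) * (\<Sum>i<p. x ^ i) = 1 - x ^ p" by (rule one_diff_power_eq[symmetric])
      ultimately show ?thesis by (simp add: poly_sum poly_monom)
    qed
    ultimately show "poly ?q x = poly ?s x" by simp
  qed
  then have "poly ?q 1 = poly ?s 1" by simp
  then show ?thesis by (simp add: poly_prod poly_sum poly_monom)
qed

text \<open>
  Pairing the factors \<open>1 - \<omega> ^ j\<close> and \<open>1 - \<omega> ^ (p - j)\<close> of \<open>p\<close> shows that \<open>p\<close> is a
  square up to a root of unity of order dividing \<open>2 * p\<close>, without Gauss sums.
\<close>

lemma sqrt_odd_prime_in_cyclotomic:
  assumes prim: "\<And>k. z ^ k = 1 \<longleftrightarrow> n dvd k" and n: "n > 0"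
    and p: "prime p" "odd p" "p dvd n" and n4: "4 dvd n"
  obtains f where "ipoly f z ^ 2 = of_nat p"
proof -
  obtain c where c: "n = p * c" using p(3) by (auto simp: dvd_def)
  obtain d where d: "n = 4 * d" using n4 by (auto simp: dvd_def)
  obtain r where r: "p = 2 * r + 1" using p(2) by (auto elim: oddE)
  define w where "w = z ^ c"
  define i where "i = z ^ d"
  have c0: "c > 0" "p > 0" using c n by (auto intro: Nat.gr0I)
  have pw: "w ^ k = 1 \<longleftrightarrow> p dvd k" for k
    using prim[of "c * k"] c0 by (simp add: w_def c mult.commute[of p c] flip: power_mult)
  have wp: "w ^ p = 1" using pw by simp
  have i2: "i ^ 2 = -1"
  proof -
    have "(i ^ 2) ^ 2 = 1" using prim[of n] by (simp add: i_def d mult.commute flip: power_mult)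
    moreover have "i ^ 2 \<noteq> 1" using prim[of "d * 2"] d n
      by (auto simp: i_def simp flip: power_mult dest: dvd_imp_le)
    ultimately show ?thesis by (metis power2_eq_1_iff)
  qed
  \<comment> \<open>As 2 (r + 1) = p + 1, the exponent makes the power of w a square root of
    w^(p-j). The factor i absorbs the sign in 1 - w^(p-j) = -w^(p-j) (1 - w^j).\<close>
  let ?y = "\<lambda>j. i * w ^ ((p - j) * (r + 1)) * (1 - w ^ j)"
  have pair: "(1 - w ^ j) * (1 - w ^ (p - j)) = ?y j ^ 2" if "j \<le> r" for j
  proof -
    have "w ^ j * w ^ (p - j) = 1" using that r wp by (simp flip: power_add)
    then have 1: "1 - w ^ (p - j) = - (w ^ (p - j)) * (1 - w ^ j)" by (simp add: algebra_simps)
    have "(w ^ ((p - j) * (r + 1))) ^ 2 = w ^ ((p - j) * (p + 1))"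
      by (simp only: r power_mult[symmetric]) (simp add: algebra_simps)
    also have "(p - j) * (p + 1) = p * (p - j) + (p - j)"
      by (simp only: distrib_left mult_1_right mult.commute[of p])
    also have "w ^ \<dots> = (w ^ p) ^ (p - j) * w ^ (p - j)" by (simp only: power_add power_mult)
    finally have 2: "(w ^ ((p - j) * (r + 1))) ^ 2 = w ^ (p - j)" by (simp add: wp)
    have "(1 - u) * (1 - v) = (i * t * (1 - u)) ^ 2"
      if "1 - v = - v * (1 - u)" "t ^ 2 = v" for t u v
    proof -
      have "(i * t * (1 - u)) ^ 2 = - v * (1 - u) * (1 - u)"
        using that(2) i2 by (simp add: power_mult_distrib) (simp add: power2_eq_square)
      then show ?thesis using that(1) by (metis mult.commute)
    qed
    from this[OF 1 2] show ?thesis .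
  qed
  have "of_nat p = (\<Prod>j\<in>{0<..<p}. 1 - w ^ j)"
    by (rule prod_one_minus_roots_of_unity[OF pw c0(2), symmetric])
  also have "{0<..<p} = {0<..r} \<union> {r<..<p}" using r by auto
  also have "(\<Prod>j\<in>\<dots>. 1 - w ^ j) = (\<Prod>j\<in>{0<..r}. 1 - w ^ j) * (\<Prod>j\<in>{r<..<p}. 1 - w ^ j)"
    by (rule prod.union_disjoint) auto
  also have "(\<Prod>j\<in>{r<..<p}. 1 - w ^ j) = (\<Prod>j\<in>{0<..r}. 1 - w ^ (p - j))"
    by (rule prod.reindex_bij_witness[of _ "\<lambda>j. p - j" "\<lambda>j. p - j"]) (use r in auto)
  also have "(\<Prod>j\<in>{0<..r}. 1 - w ^ j) * \<dots> = (\<Prod>j\<in>{0<..r}. ?y j ^ 2)"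
    unfolding prod.distrib[symmetric] by (rule prod.cong) (use pair in auto)
  also have "\<dots> = (\<Prod>j\<in>{0<..r}. ?y j) ^ 2" by (rule prod_power_distrib[symmetric])
  also have "(\<Prod>j\<in>{0<..r}. ?y j) = ipoly (\<Prod>j\<in>{0<..r}. monom 1 d *
      monom 1 (c * ((p - j) * (r + 1))) * (1 - monom 1 (c * j))) z"
  proof -
    have ipoly_prod: "ipoly (\<Prod>j\<in>A. F j) z = (\<Prod>j\<in>A. ipoly (F j) z)" for F and A :: "nat set"
      by (induction A rule: infinite_finite_induct) (simp_all add: ipoly_mult)
    show ?thesis unfolding ipoly_prod
      by (rule prod.cong) (simp_all add: ipoly_simps i_def w_def power_mult)
  qed
  finally show ?thesis by (rule that[OF sym])
qed

text \<open>For a primitive 8th root of unity e, \<open>e - e ^ 3\<close> is e + 1/e, that is, twice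
  the cosine of an odd multiple of pi/4.\<close>

lemma sqrt_2_in_cyclotomic:
  assumes prim: "\<And>k. z ^ k = 1 \<longleftrightarrow> n dvd k" and n: "n > 0" "8 dvd n"
  obtains f where "ipoly f z ^ 2 = 2"
proof -
  obtain d where d: "n = 8 * d" using n(2) by (auto simp: dvd_def)
  define e where "e = z ^ d"
  have "(e ^ 4) ^ 2 = 1" using prim[of n] by (simp add: e_def d mult.commute flip: power_mult)
  moreover have "e ^ 4 \<noteq> 1" using prim[of "d * 4"] d n
    by (auto simp: e_def simp flip: power_mult dest: dvd_imp_le)
  ultimately have e4: "e ^ 4 = -1" by (metis power2_eq_1_iff)
  have "(e - e ^ 3) ^ 2 = e ^ 2 * (1 + e ^ 4) - 2 * e ^ 4"
    by (simp add: eval_nat_numeral algebra_simps)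
  then have "(e - e ^ 3) ^ 2 = 2" using e4 by simp
  moreover have "ipoly (monom 1 d - monom 1 (d * 3)) z = e - e ^ 3"
    by (simp add: ipoly_simps e_def power_mult)
  ultimately show ?thesis using that by metis
qed

lemma sqrt_in_cyclotomic:
  assumes prim: "\<And>k. z ^ k = 1 \<longleftrightarrow> n dvd k" and n: "n > 0" "4 dvd n" and a: "a > 0"
    and p: "\<And>p. prime p \<Longrightarrow> p dvd a \<Longrightarrow> p dvd n \<and> (p = 2 \<longrightarrow> 8 dvd n)"
  shows "\<exists>f. ipoly f z ^ 2 = of_nat a"
  using a p
proof (induction a rule: prime_divisors_induct)
  case zero
  then show ?case by simp
next
  case (unit a)
  then show ?case by (intro exI[of _ 1]) simp
next
  case (factor q a)
  have "\<exists>f. ipoly f z ^ 2 = of_nat a"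
  proof (rule factor.IH)
    show "a > 0" using factor.prems(1) by simp
    show "p dvd n \<and> (p = 2 \<longrightarrow> 8 dvd n)" if "prime p" "p dvd a" for p
      using factor.prems(2)[of p] that by simp
  qed
  then obtain f where f: "ipoly f z ^ 2 = of_nat a" by blast
  have "\<exists>g. ipoly g z ^ 2 = of_nat q"
  proof (cases "q = 2")
    case True
    have "8 dvd n" using factor.prems(2)[of q] factor.hyps True by simp
    then show ?thesis using sqrt_2_in_cyclotomic[OF prim n(1)] True by (metis of_nat_numeral)
  next
    case False
    have "q dvd n" using factor.prems(2)[of q] factor.hyps by simp
    moreover have "odd q" using False factor.hyps by (metis prime_odd_nat prime_ge_2_nat le_neq_implies_less)
    ultimately show ?thesis using sqrt_odd_prime_in_cyclotomic[OF prim n(1)] factor.hyps n(2) by metis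
  qed
  then obtain g where "ipoly g z ^ 2 = of_nat q" by blast
  with f have "ipoly (g * f) z ^ 2 = of_nat (q * a)" by (simp add: ipoly_mult power_mult_distrib)
  then show ?case by blast
qed

text \<open>Given that 4 divides n, the condition on the right says that the discriminant of the
  quadratic field of the square root of a divides n. The generator is presented as a square z'^2
  because excluding the square root of 2 uses conjugates of z'.\<close>

theorem sqrt_in_cyclotomic_iff:
  fixes z' :: complex
  assumes prim: "\<And>k. z' ^ k = 1 \<longleftrightarrow> 2 * n dvd k" and n: "n > 0" "4 dvd n" and a: "squarefree a"
  shows "(\<exists>x\<in>Qadj (z' ^ 2). x ^ 2 = of_nat a) \<longleftrightarrow>
    (\<forall>p. prime p \<longrightarrow> p dvd a \<longrightarrow> p dvd n \<and> (p = 2 \<longrightarrow> 8 dvd n))"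
proof -
  let ?z = "z' ^ 2"
  have prim': "?z ^ k = 1 \<longleftrightarrow> n dvd k" for k
    using prim[of "2 * k"] by (simp flip: power_mult)
  have zn: "?z ^ n = 1" using prim' by simp
  have a0: "a > 0" using a by (auto intro: Nat.gr0I)
  show ?thesis
  proof
    assume "\<exists>x\<in>Qadj ?z. x ^ 2 = of_nat a"
    then obtain x where x: "x \<in> Qadj ?z" "x ^ 2 = of_nat a" by blast
    have dvd: "p dvd n" if "prime p" "p dvd a" for p
      using sqrt_in_cyclotomic_imp_dvd[OF zn n(1) x a that] .
    have "8 dvd n" if even: "2 dvd a"
    proof (rule ccontr)
      assume n8: "\<not> 8 dvd n"
      obtain c where c: "a = 2 * c" using even by (rule dvdE)
      have "odd c"
      proof
        assume "even c"
        then have "2 ^ 2 dvd a" using c by (auto elim!: evenE)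
        then have "is_unit (2 :: nat)" using a unfolding squarefree_def by blast
        then show False by simp
      qed
      have c0: "c > 0" using c a0 by simp
      have "\<exists>f. ipoly f ?z ^ 2 = of_nat c"
      proof (rule sqrt_in_cyclotomic[OF prim' n c0])
        show "p dvd n \<and> (p = 2 \<longrightarrow> 8 dvd n)" if "prime p" "p dvd c" for p
          using \<open>odd c\<close> dvd[of p] c that by auto
      qed
      then obtain f where f: "ipoly f ?z ^ 2 = of_nat c" by blast
      \<comment> \<open>With a = 2c and the square root of c already in the field, this is a square
        root of 2.\<close>
      have "x * ipoly f ?z / of_nat c \<in> Qadj ?z"
        by (intro Qadj_div_nat Qadj_mult ipoly_in_Qadj x c0)
      moreover have "(x * ipoly f ?z / of_nat c) ^ 2 = 2"
        unfolding power_mult_distrib power_divide x(2) f c using c0 by (simp add: power2_eq_square)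
      ultimately show False using sqrt_2_notin_cyclotomic[OF prim n(2) n8 n(1)] by blast
    qed
    then show "\<forall>p. prime p \<longrightarrow> p dvd a \<longrightarrow> p dvd n \<and> (p = 2 \<longrightarrow> 8 dvd n)"
      using dvd by blast
  next
    assume "\<forall>p. prime p \<longrightarrow> p dvd a \<longrightarrow> p dvd n \<and> (p = 2 \<longrightarrow> 8 dvd n)"
    then have "\<exists>f. ipoly f ?z ^ 2 = of_nat a"
      by (intro sqrt_in_cyclotomic[OF prim' n a0]) blast
    then show "\<exists>x\<in>Qadj ?z. x ^ 2 = of_nat a" using ipoly_in_Qadj by blast
  qed
qed

section \<open>Degrees of Kummer fields\<close>

lemma complex_field_simps [simp]:
  "carrier complex_field = UNIV" "monoid.mult complex_field = (*)" "monoid.one complex_field = 1"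
  "ring.zero complex_field = 0" "ring.add complex_field = (+)"
  by (simp_all add: ring_of_type_algebra_def)

lemma field_complex_field: "Ring.field complex_field"
  by (rule field_from_type_algebra)

interpretation CF: domain complex_field
  by (rule field.axioms(1)[OF field_complex_field])

lemma complex_field_a_inv [simp]: "a_inv complex_field x = - x"
  using CF.minus_equality[of "- x" x] by simp

lemma complex_field_m_inv [simp]: "x \<noteq> 0 \<Longrightarrow> m_inv complex_field x = inverse x"
  using CF.comm_inv_char[of x "inverse x"] by simp

lemma complex_field_nat_pow [simp]: "x [^]\<^bsub>complex_field\<^esub> (n :: nat) = x ^ n"
  by (induction n) simp_all

lemma subfield_complexD:
  assumes "subfield K complex_field"
  shows "0 \<in> K" "1 \<in> K" "x \<in> K \<Longrightarrow> - x \<in> K" "x \<in> K \<Longrightarrow> y \<in> K \<Longrightarrow> x + y \<in> K"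
    "x \<in> K \<Longrightarrow> y \<in> K \<Longrightarrow> x * y \<in> K" "x \<in> K \<Longrightarrow> inverse x \<in> K" "x \<in> K \<Longrightarrow> x ^ n \<in> K"
    "of_nat n \<in> K" "of_int i \<in> K"
proof -
  note K = subringE[OF subfieldE(1)[OF assms], simplified]
  show 0: "0 \<in> K" "1 \<in> K" and uminus: "x \<in> K \<Longrightarrow> - x \<in> K" for x using K by auto
  show add: "x \<in> K \<Longrightarrow> y \<in> K \<Longrightarrow> x + y \<in> K"
    and mult: "x \<in> K \<Longrightarrow> y \<in> K \<Longrightarrow> x * y \<in> K" for x y using K by auto
  show "x \<in> K \<Longrightarrow> inverse x \<in> K"
    using CF.subfield_m_inv(1)[OF assms, of x] 0 by (cases "x = 0") auto
  show "x \<in> K \<Longrightarrow> x ^ n \<in> K" by (induction n) (auto intro: 0 mult)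
  have nat: "of_nat n \<in> K" for n by (induction n) (auto intro: 0 add)
  then show "of_nat n \<in> K" .
  show "of_int i \<in> K" by (cases i rule: int_cases2) (auto intro: nat uminus)
qed

lemma subfield_complexI:
  assumes "1 \<in> K" "\<And>x. x \<in> K \<Longrightarrow> - x \<in> K" "\<And>x y. x \<in> K \<Longrightarrow> y \<in> K \<Longrightarrow> x + y \<in> K"
    "\<And>x y. x \<in> K \<Longrightarrow> y \<in> K \<Longrightarrow> x * y \<in> K" "\<And>x. x \<in> K \<Longrightarrow> inverse x \<in> K"
  shows "subfield K complex_field"
  by (rule field.subfieldI'[OF field_complex_field CF.subringI]) (use assms in auto)

lemma subfield_Rats: "subfield \<rat> complex_field"
  by (rule subfield_complexI) auto

lemma Rats_subset_subfield:
  assumes "subfield K complex_field"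
  shows "\<rat> \<subseteq> K"
proof
  note K = subfield_complexD[OF assms]
  fix x :: complex assume "x \<in> \<rat>"
  then obtain q where "x = of_rat q" by (rule Rats_cases)
  moreover obtain a b where "quotient_of q = (a, b)" by (cases "quotient_of q")
  then have "q = of_int a / of_int b" by (rule quotient_of_div)
  ultimately have "x = of_int a / of_int b" by (metis of_rat_divide of_rat_of_int_eq)
  then show "x \<in> K" using K by (simp add: divide_inverse)
qed

section \<open>Minimal polynomials and dimensions over subfields of the complex numbers\<close>

lemma eval_complex_field: "CF.eval l x = poly (Poly (rev l)) x"
  by (induction l) (simp_all add: Poly_append poly_monom)

lemma poly_eq_eval_rev_coeffs: "poly p x = CF.eval (rev (coeffs p)) x"
  by (simp add: eval_complex_field)

text \<open>Polynomials of HOL-Algebra are coefficient lists headed by a nonzero leading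
  coefficient, whereas \<open>coeffs\<close> ends with it; hence the reversal.\<close>

lemma rev_coeffs_in_carrier:
  assumes "subfield K complex_field" "\<And>i. coeff p i \<in> K"
  shows "rev (coeffs p) \<in> carrier (K[X]\<^bsub>complex_field\<^esub>)"
proof (cases "p = 0")
  case False
  have "hd (rev (coeffs p)) \<noteq> 0"
    using False by (simp add: hd_rev last_coeffs_eq_coeff_degree)
  moreover have "set (coeffs p) \<subseteq> K"
    using assms(2) range_coeff[of p] by (metis image_subset_iff insert_subset)
  ultimately show ?thesis by (simp add: polynomial_def flip: univ_poly_carrier)
qed (simp add: polynomial_def flip: univ_poly_carrier)

text \<open>Carries \<open>CF.Irr\<close> over to the type of complex polynomials, where
  factorization into linear factors is at hand. The last property is divisibility by q in the form
  in which it is used: roots of q, the conjugates of x, satisfy every equation of x over K.\<close>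

lemma minimal_polynomial_over_subfield:
  assumes K: "subfield K complex_field"
    and p0: "p0 \<noteq> 0" "\<And>i. coeff p0 i \<in> K" "poly p0 x = 0"
  obtains q :: "complex poly" where "lead_coeff q = 1" "\<And>i. coeff q i \<in> K" "poly q x = 0"
    "subfield (CF.simple_extension K x) complex_field"
    "CF.dimension (degree q) K (CF.simple_extension K x)"
    "\<forall>p. p \<noteq> 0 \<longrightarrow> (\<forall>i. coeff p i \<in> K) \<longrightarrow> poly p x = 0 \<longrightarrow> degree q \<le> degree p"
    "\<forall>p w. (\<forall>i. coeff p i \<in> K) \<longrightarrow> poly p x = 0 \<longrightarrow> poly q w = 0 \<longrightarrow> poly p w = 0"
proof -
  note subring = subfieldE(1)[OF K]
  have alg: "(CF.algebraic over K) x"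
    using p0 by (intro CF.algebraicI[of "rev (coeffs p0)"] rev_coeffs_in_carrier[OF K])
      (simp_all add: eval_complex_field)
  define I where "I = CF.Irr K x"
  note Irr = CF.IrrE[OF K _ alg, folded I_def, simplified]
  define q where "q = Poly (rev I)"
  have I_K: "set I \<subseteq> K" and I_ne: "I \<noteq> []"
    using Irr(1,2) by (auto simp: polynomial_def ring_irreducible_def univ_poly_zero simp flip: univ_poly_carrier)
  have hd: "hd I = 1" using Irr(3) by simp
  have cq: "coeffs q = rev I"
  proof -
    have "strip_while ((=) 0) (rev I) = rev I"
      by (rule strip_while_idem_iff[THEN iffD2]) (use hd I_ne in \<open>cases I; simp add: no_trailing_unfold last_rev\<close>)
    then show ?thesis by (simp add: q_def)
  qed
  have q0: "q \<noteq> 0" using cq I_ne by auto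
  have dq: "degree q = length I - 1" using cq q0 by (simp add: degree_eq_length_coeffs)
  have div: "CF.eval I w = 0 \<Longrightarrow> poly p w = 0" "p \<noteq> 0 \<Longrightarrow> degree q \<le> degree p"
    if p: "\<And>i. coeff p i \<in> K" "poly p x = 0" for p w
  proof -
    have carr: "rev (coeffs p) \<in> carrier (K[X]\<^bsub>complex_field\<^esub>)" by (rule rev_coeffs_in_carrier[OF K p(1)])
    have dvd: "I pdivides\<^bsub>complex_field\<^esub> rev (coeffs p)"
      unfolding I_def using p(2) by (intro CF.Irr_minimal[OF K _ alg carr]) (simp_all add: eval_complex_field)
    { assume "p \<noteq> 0"
      then have "rev (coeffs p) \<noteq> []" by simp
      from CF.pdivides_imp_degree_le[OF subring Irr(1) carr this dvd]
      show "degree q \<le> degree p" using \<open>p \<noteq> 0\<close> by (simp add: cq degree_eq_length_coeffs) }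
    assume Iw: "CF.eval I w = 0"
    obtain b where b: "b \<in> carrier (poly_ring complex_field)"
      "rev (coeffs p) = I \<otimes>\<^bsub>poly_ring complex_field\<^esub> b"
      using dvd unfolding pdivides_def factor_def by blast
    have "I \<in> carrier (poly_ring complex_field)"
      using Irr(1) CF.carrier_polynomial_shell[OF subring] by simp
    with b have "CF.eval (rev (coeffs p)) w = CF.eval I w * CF.eval b w"
      using ring_hom_mult[OF CF.eval_is_hom[OF CF.carrier_is_subring, of w]] by simp
    then show "poly p w = 0" using Iw by (simp add: poly_eq_eval_rev_coeffs)
  qed
  show ?thesis
  proof (rule that[of q])
    show "lead_coeff q = 1"
      using hd I_ne q0 by (simp flip: last_coeffs_eq_coeff_degree add: cq last_rev)
    show "coeff q i \<in> K" for i
      using I_K range_coeff[of q] subfield_complexD(1)[OF K] cq by (metis insertE rangeI set_rev subsetD)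
    show "poly q x = 0" using Irr(4) by (simp add: q_def eval_complex_field)
    show "subfield (CF.simple_extension K x) complex_field"
      using CF.simple_extension_is_subfield[OF K] alg by simp
    show "CF.dimension (degree q) K (CF.simple_extension K x)"
      using CF.dimension_simple_extension[OF K _ alg] by (simp add: dq I_def)
    show "\<forall>p. p \<noteq> 0 \<longrightarrow> (\<forall>i. coeff p i \<in> K) \<longrightarrow> poly p x = 0 \<longrightarrow> degree q \<le> degree p"
      using div(2) by blast
    show "\<forall>p w. (\<forall>i. coeff p i \<in> K) \<longrightarrow> poly p x = 0 \<longrightarrow> poly q w = 0 \<longrightarrow> poly p w = 0"
      using div(1) by (simp add: q_def eval_complex_field)
  qed
qed

lemma simple_extension_Rats: "CF.simple_extension \<rat> z = Qadj z"
proof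
  show "CF.simple_extension \<rat> z \<subseteq> Qadj z"
  proof
    fix x assume "x \<in> CF.simple_extension \<rat> z"
    then show "x \<in> Qadj z"
    proof (induction rule: CF.simple_extension.induct)
      case zero
      show ?case using ipoly_in_Qadj[of 0 z] by simp
    next
      case (lin k1 k2)
      then obtain f M where k1: "k1 = ipoly f z / of_nat M" "M > 0" unfolding Qadj_def by blast
      obtain q where "k2 = of_rat q" using lin by (auto elim: Rats_cases)
      moreover obtain a b where ab: "quotient_of q = (a, b)" by (cases "quotient_of q")
      have b: "b > 0" using quotient_of_denom_pos[OF ab] .
      have "q = of_int a / of_int b" using quotient_of_div[OF ab] .
      ultimately have k2: "k2 = of_int a / of_int b" by (metis of_rat_divide of_rat_of_int_eq)
      \<comment> \<open>A Horner step: multiplication by z shifts f, and the denominators M of k1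
        and b of k2 merge into their product.\<close>
      have "k1 * z + k2 = ipoly (smult b (pCons 0 f) + [:int M * a:]) z / of_nat (M * nat b)"
        using k1 b by (simp add: k2 ipoly_simps field_simps of_nat_nat)
      moreover have "M * nat b > 0" using k1 b by simp
      ultimately have "k1 * z + k2 \<in> Qadj z" unfolding Qadj_def by blast
      then show ?case by simp
    qed
  qed
  show "Qadj z \<subseteq> CF.simple_extension \<rat> z"
  proof
    fix x assume "x \<in> Qadj z"
    then obtain f M where x: "x = ipoly f z / of_nat M" "M > 0" unfolding Qadj_def by blast
    let ?S = "CF.simple_extension \<rat> z"
    have sr: "subring \<rat> complex_field" by (rule subfieldE(1)[OF subfield_Rats])
    note S = subringE[OF CF.simple_extension_is_subring[OF sr, of z], simplified]
    have incl: "\<rat> \<subseteq> ?S" by (rule CF.simple_extension_incl) simp_all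
    have mem: "z \<in> ?S" by (rule CF.simple_extension_mem[OF sr]) simp
    have "ipoly f z \<in> ?S"
    proof (induction f)
      case 0
      then show ?case using S by simp
    next
      case (pCons c f)
      have "of_int c \<in> ?S" using incl by auto
      then show ?case unfolding ipoly_pCons using S(6,7) mem pCons.IH by blast
    qed
    moreover have "inverse (of_nat M) \<in> ?S" using incl by auto
    ultimately show "x \<in> ?S" using S x by (simp add: divide_inverse)
  qed
qed

lemma rational_poly_denominator:
  fixes p :: "complex poly"
  assumes "\<And>i. coeff p i \<in> \<rat>"
  obtains M F where "M > 0" "smult (of_nat M) p = map_poly of_int F"
proof -
  have "\<exists>M F. M > 0 \<and> smult (of_nat M) p = map_poly of_int F"
    using assms
  proof (induction p)
    case 0
    then show ?case by (intro exI[of _ 1] exI[of _ 0]) simp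
  next
    case (pCons c p)
    have "coeff p i \<in> \<rat>" for i using pCons.prems[of "Suc i"] by simp
    then obtain M F where MF: "M > 0" "smult (of_nat M) p = map_poly of_int F"
      using pCons.IH by blast
    have "c \<in> \<rat>" using pCons.prems[of 0] by simp
    then obtain q where "c = of_rat q" by (auto elim: Rats_cases)
    moreover obtain a b where ab: "quotient_of q = (a, b)" by (cases "quotient_of q")
    have b: "b > 0" using quotient_of_denom_pos[OF ab] .
    have "q = of_int a / of_int b" using quotient_of_div[OF ab] .
    ultimately have c: "c = of_int a / of_int b" by (metis of_rat_divide of_rat_of_int_eq)
    have "smult (of_nat (M * nat b)) (pCons c p) = pCons (of_int (int M * a)) (smult (of_int b) (smult (of_nat M) p))"
      using b by (simp add: c mult.commute)
    also have "\<dots> = map_poly of_int (pCons (int M * a) (smult b F))"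
      by (simp add: MF(2) map_poly_pCons map_poly_of_int_smult)
    finally show ?case using MF(1) b by (intro exI[of _ "M * nat b"] exI) auto
  qed
  then show ?thesis using that by blast
qed

text \<open>The minimal polynomial over the rationals is no longer than the integral one g by
  minimality, and no shorter since clearing its denominators gives a nonzero multiple of g.\<close>

lemma cyclotomic_field:
  fixes z :: complex
  assumes prim: "\<And>k. z ^ k = 1 \<longleftrightarrow> n dvd k" and n: "n > 0"
  shows "subfield (Qadj z) complex_field" "CF.dimension (totient n) \<rat> (Qadj z)"
proof -
  have zn: "z ^ n = 1" using prim by simp
  obtain g where g: "lead_coeff g = 1" "\<And>f. ipoly f z = 0 \<longleftrightarrow> g dvd f"
    using root_of_unity_minimal_polynomial[OF zn n] by blast
  have dg: "degree g = totient n" by (rule degree_cyclotomic[OF prim n g])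
  let ?g = "map_poly of_int g :: complex poly"
  have g0: "?g \<noteq> 0" using g(1) by (auto simp: map_poly_eq_0_iff)
  have gz: "poly ?g z = 0" using g(2)[of g] by simp
  have gK: "coeff ?g i \<in> \<rat>" for i by (simp add: coeff_map_poly)
  obtain q :: "complex poly" where q: "lead_coeff q = 1" "\<And>i. coeff q i \<in> \<rat>" "poly q z = 0"
    "subfield (Qadj z) complex_field" "CF.dimension (degree q) \<rat> (Qadj z)"
    "\<forall>p. p \<noteq> 0 \<longrightarrow> (\<forall>i. coeff p i \<in> \<rat>) \<longrightarrow> poly p z = 0 \<longrightarrow> degree q \<le> degree p"
    by (rule minimal_polynomial_over_subfield[OF subfield_Rats g0 gK gz, unfolded simple_extension_Rats])
      (rule that)
  have q6: "degree q \<le> degree ?g" using q(6) g0 gK gz by blast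
  obtain M F where MF: "M > 0" "smult (of_nat M) q = map_poly of_int F"
    using rational_poly_denominator[of q] q(2) by blast
  have "ipoly F z = of_nat M * poly q z" by (simp flip: MF(2))
  then have "g dvd F" using q(3) g(2) by simp
  moreover have "F \<noteq> 0"
  proof
    assume "F = 0"
    then have "smult (of_nat M) q = 0" using MF(2) by simp
    then show False using MF(1) q(1) by auto
  qed
  ultimately have "degree g \<le> degree F" by (rule dvd_imp_degree_le)
  also have "degree F = degree (smult (of_nat M) q)" by (simp add: MF(2) degree_map_poly)
  also have "\<dots> = degree q" using MF(1) by simp
  finally have "degree q = totient n" using q6 dg by (simp add: degree_map_poly)
  then show "subfield (Qadj z) complex_field" "CF.dimension (totient n) \<rat> (Qadj z)"
    using q(4,5) by auto
qed

section \<open>Real radicals over cyclotomic fields\<close>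

lemma of_real_of_rat: "of_real (of_rat q) = (of_rat q :: complex)"
  by (cases q) (simp add: of_rat_rat)

text \<open>Write t / N in lowest terms as u / v, so c^v = b^u. A Bezout relation between u and v
  exhibits b as a v-th power, whence v = 1.\<close>

lemma not_power_imp_dvd_exponent:
  fixes b c :: rat
  assumes b: "b > 0" "\<nexists>(q::rat) n::nat. n \<ge> 2 \<and> b = q ^ n"
    and c: "c > 0" "c ^ N = b ^ t" and N: "N > 0"
  shows "N dvd t"
proof (cases "t = 0")
  case False
  define g where "g = gcd t N"
  obtain u v where uv: "t = u * g" "N = v * g" "coprime u v"
    using gcd_coprime_exists[of t N] N unfolding g_def by auto
  have g: "g > 0" "u > 0" "v > 0" using uv N False by auto
  have "(c ^ v) ^ g = (b ^ u) ^ g" using c(2) uv by (simp flip: power_mult)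
  then have cb: "c ^ v = b ^ u"
    by (rule power_eq_imp_eq_base) (use b(1) c(1) g in auto)
  obtain x y where xy: "u * x = v * y + 1"
    using bezout_nat[of u v] uv(3) g(2) by (metis coprime_imp_gcd_eq_1 less_irrefl)
  have "b * (b ^ y) ^ v = b ^ (v * y + 1)" by (simp add: power_mult mult.commute flip: power_mult)
  also have "\<dots> = (c ^ v) ^ x" by (simp only: cb power_mult flip: xy)
  finally have "b * (b ^ y) ^ v = (c ^ x) ^ v" by (simp add: mult.commute flip: power_mult)
  then have "b = (c ^ x / b ^ y) ^ v" using b(1) by (simp add: power_divide field_simps)
  then have "\<not> v \<ge> 2" using b(2) by blast
  then have "v = 1" using g by simp
  then show ?thesis using uv by simp
qed simp

lemma prod_mset_power:
  "(\<Prod>x\<in>#A. f x) ^ k = (\<Prod>x\<in>#A. f x ^ k :: 'a :: comm_semiring_1)"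
  by (induction A) (simp_all add: power_mult_distrib)

text \<open>The conjugates of \<alpha> over K differ from it by N-th roots of unity. Hence the
  constant coefficient of its minimal polynomial is a root of unity in K times \<alpha>^s, with s
  the degree, and \<alpha>^s lies in K. No smaller positive power does, since a binomial x^k -
  \<alpha>^k over K has degree at least s.\<close>

lemma kummer_degree:
  fixes z :: complex and \<alpha> :: real and b :: rat
  assumes prim: "\<And>k. z ^ k = 1 \<longleftrightarrow> n dvd k" and n: "n > 0" "2 * N dvd n"
    and b: "b > 0" "\<nexists>(q::rat) n::nat. n \<ge> 2 \<and> b = q ^ n"
    and \<alpha>: "\<alpha> > 0" "\<alpha> ^ N = of_rat b" and N: "N > 0"
  defines "K \<equiv> Qadj z"
  shows "subfield (CF.simple_extension K (of_real \<alpha>)) complex_field"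
    and "CF.dimension (if even N \<and> (\<exists>x\<in>K. x ^ 2 = of_rat b) then N div 2 else N) K
      (CF.simple_extension K (of_real \<alpha>))"
proof -
  have K: "subfield K complex_field" unfolding K_def by (rule cyclotomic_field(1)[OF prim n(1)])
  note Ks = subfield_complexD[OF K]
  let ?a = "of_real \<alpha> :: complex"
  have aN: "?a ^ N = of_rat b" using \<alpha>(2) by (metis of_real_of_rat of_real_power)
  have bK: "of_rat b \<in> K" using Rats_subset_subfield[OF K] by auto
  let ?bin = "\<lambda>k. monom 1 k - [:?a ^ k:]"
  have bin: "?bin k \<noteq> 0 \<and> degree (?bin k) = k \<and> poly (?bin k) w = w ^ k - ?a ^ k" if "k > 0" for k w
  proof -
    have "degree (?bin k) = k"
      using that by (intro antisym degree_diff_le le_degree) (auto simp: degree_monom_le coeff_pCons split: nat.splits)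
    moreover from this have "?bin k \<noteq> 0" using that by (metis degree_0 less_irrefl)
    ultimately show ?thesis by (simp add: poly_monom)
  qed
  have binK: "coeff (?bin k) i \<in> K" if "?a ^ k \<in> K" for k i
  proof -
    have 1: "- (?a ^ k) \<in> K" using that Ks by auto
    then have "1 - ?a ^ k \<in> K" using Ks(4)[OF Ks(2) 1] by simp
    note this 1
    then show ?thesis using Ks(1,2) by (auto simp: coeff_pCons split: nat.splits)
  qed
  have aNK: "?a ^ N \<in> K" using aN bK by simp
  have binN: "?bin N \<noteq> 0" "\<And>i. coeff (?bin N) i \<in> K" "poly (?bin N) ?a = 0"
    using bin[OF N, of ?a] binK[OF aNK] by auto
  obtain q :: "complex poly" where q: "lead_coeff q = 1" "\<And>i. coeff q i \<in> K" "poly q ?a = 0"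
    "subfield (CF.simple_extension K ?a) complex_field"
    "CF.dimension (degree q) K (CF.simple_extension K ?a)"
    "\<forall>p. p \<noteq> 0 \<longrightarrow> (\<forall>i. coeff p i \<in> K) \<longrightarrow> poly p ?a = 0 \<longrightarrow> degree q \<le> degree p"
    "\<forall>p w. (\<forall>i. coeff p i \<in> K) \<longrightarrow> poly p ?a = 0 \<longrightarrow> poly q w = 0 \<longrightarrow> poly p w = 0"
    by (rule minimal_polynomial_over_subfield[OF K binN]) (rule that)
  define s where "s = degree q"
  have s_le: "s \<le> k" if "k > 0" "?a ^ k \<in> K" for k
    using q(6)[rule_format, of "?bin k"] bin[OF that(1), of ?a] binK[OF that(2)] by (simp add: s_def)
  have root: "w ^ N = ?a ^ N" if "poly q w = 0" for w
    using q(7)[rule_format, of "?bin N" w] bin[OF N, of w] binN(2,3) that by simp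
  have s0: "s > 0"
  proof (rule ccontr)
    assume "\<not> s > 0"
    then obtain c where "q = [:c:]" unfolding s_def using degree_eq_zeroE by blast
    with q(1,3) show False by simp
  qed
  have asK: "?a ^ s \<in> K"
  proof -
    have decomp: "(\<Prod>x\<in>#proots q. [:- x, 1:]) = q"
      using complex_poly_decompose_multiset[of q] q(1) by simp
    have q0: "q \<noteq> 0" using q(1) by auto
    have size: "size (proots q) = s"
      by (simp add: size_proots_complex s_def)
    define c where "c = coeff q 0"
    have "c = poly q 0" by (simp add: c_def poly_0_coeff_0)
    also have "\<dots> = (\<Prod>x\<in>#proots q. - x)"
      by (subst decomp[symmetric]) (simp add: poly_prod_mset image_mset.compositionality o_def)
    \<comment> \<open>The exponent 2N kills the N-th roots of unity separating the conjugates and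
      also the signs in front of them; this is why 2N, not N, has to divide n.\<close>
    finally have "c ^ (2 * N) = (\<Prod>x\<in>#proots q. (- x) ^ (2 * N))"
      by (simp add: prod_mset_power)
    also have "\<dots> = (\<Prod>x\<in>#proots q. ?a ^ (2 * N))"
    proof (intro arg_cong[where f = prod_mset] image_mset_cong)
      fix x assume "x \<in># proots q"
      then have "x ^ N = ?a ^ N" using root q0 by simp
      then have "(x ^ N) ^ 2 = (?a ^ N) ^ 2" by simp
      then show "(- x) ^ (2 * N) = ?a ^ (2 * N)"
        by (simp add: power_mult) (simp add: mult.commute flip: power_mult)
    qed
    also have "\<dots> = (?a ^ (2 * N)) ^ s" by (simp add: size)
    finally have "(c / ?a ^ s) ^ (2 * N) = 1"
      using \<alpha>(1) by (simp add: power_divide mult.commute flip: power_mult)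
    moreover obtain k where k: "n = 2 * N * k" using n(2) by (rule dvdE)
    ultimately have un: "(c / ?a ^ s) ^ n = 1" by (simp add: power_mult)
    then obtain j where j: "c / ?a ^ s = z ^ j"
      using primitive_root_powers(2)[OF prim n(1)] by blast
    have zK: "z \<in> K" using ipoly_in_Qadj[of "monom 1 1" z] by (simp add: K_def ipoly_monom)
    have "z \<noteq> 0" using prim[of n] n(1) by (auto simp: zero_power)
    moreover have "c = z ^ j * ?a ^ s" using j \<alpha>(1) by (simp add: field_simps)
    ultimately have "?a ^ s = c * inverse (z ^ j)" by simp
    then show ?thesis using Ks zK q(2) by (simp add: c_def)
  qed
  have sN: "s \<le> N" using s_le[OF N] aN bK by simp
  \<comment> \<open>The real number \<alpha>^s is a radical in K, so its square is a rational c with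
    c^N = b^(2s). Together with s \<le> N this leaves only s = N and s = N/2.\<close>
  have "N dvd 2 * s"
  proof -
    have "(?a ^ s) ^ N = (?a ^ N) ^ s" by (simp add: mult.commute flip: power_mult)
    then have "(?a ^ s) ^ N \<in> \<rat>" using aN by simp
    then have "(?a ^ s) ^ 2 \<in> \<rat>"
      using real_radical_in_cyclotomic[OF prim n(1) asK[unfolded K_def] _ _ N] by simp
    then obtain c where c: "(?a ^ s) ^ 2 = of_rat c" by (auto elim: Rats_cases)
    then have "complex_of_real ((\<alpha> ^ s) ^ 2) = of_real (of_rat c)" by (simp only: of_real_power of_real_of_rat)
    then have c': "(\<alpha> ^ s) ^ 2 = of_rat c" using of_real_eq_iff by blast
    then have "of_rat c > (0 :: real)" using \<alpha>(1) by (metis zero_less_power)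
    then have c0: "c > 0" by simp
    have "of_rat (c ^ N) = ((\<alpha> ^ s) ^ 2) ^ N" by (simp only: c' of_rat_power)
    also have "\<dots> = (\<alpha> ^ N) ^ (2 * s)" by (simp add: mult_ac flip: power_mult)
    also have "\<dots> = of_rat (b ^ (2 * s))" by (simp only: \<alpha>(2) of_rat_power)
    finally have "c ^ N = b ^ (2 * s)" by (simp only: of_rat_eq_iff)
    then show ?thesis by (rule not_power_imp_dvd_exponent[OF b c0 _ N])
  qed
  then obtain e where e: "2 * s = N * e" by (rule dvdE)
  have e12: "e = 1 \<or> e = 2"
  proof -
    have "N * e \<le> N * 2" using sN by (simp flip: e)
    then have "e \<le> 2" using nat_mult_le_cancel1[OF N] by blast
    moreover have "e \<noteq> 0" using e s0 by (metis mult_0_right mult_eq_0_iff neq0_conv zero_neq_numeral)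
    ultimately show ?thesis by auto
  qed
  have "s = (if even N \<and> (\<exists>x\<in>K. x ^ 2 = of_rat b) then N div 2 else N)"
  proof (cases "even N \<and> (\<exists>x\<in>K. x ^ 2 = of_rat b)")
    case True
    then obtain x where x: "x \<in> K" "x ^ 2 = of_rat b" by blast
    obtain h where h: "N = 2 * h" using True by blast
    have "(?a ^ h) ^ 2 = x ^ 2" using aN h x by (simp add: mult.commute flip: power_mult)
    then have "?a ^ h = x \<or> ?a ^ h = - x" by (simp add: power2_eq_iff)
    then have "?a ^ h \<in> K" using x Ks by auto
    then have "s \<le> h" using s_le[of h] N h by simp
    then have "s = h" using e12 e h s0 by auto
    then show ?thesis using True h by simp
  next
    case False
    have "e \<noteq> 1"
    proof
      assume "e = 1"
      then have N2: "N = 2 * s" using e by simp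
      then have "(?a ^ s) ^ 2 = of_rat b" using aN by (simp add: mult.commute flip: power_mult)
      then show False using False asK N2 by auto
    qed
    then show ?thesis using False e e12 by auto
  qed
  then show "subfield (CF.simple_extension K (of_real \<alpha>)) complex_field"
    and "CF.dimension (if even N \<and> (\<exists>x\<in>K. x ^ 2 = of_rat b) then N div 2 else N) K
      (CF.simple_extension K (of_real \<alpha>))"
    using q(4,5) by (simp_all add: s_def)
qed

section \<open>The Kummer fields of the group generated by -1 and a\<close>

lemma zeta_power_eq_1_iff:
  assumes "n > 0"
  shows "zeta n ^ k = 1 \<longleftrightarrow> n dvd k"
proof -
  have "zeta n ^ k = exp (2 * of_real pi * \<i> * of_nat k / of_nat n)"
    unfolding zeta_def by (simp flip: exp_of_nat_mult add: algebra_simps)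
  also have "\<dots> = 1 \<longleftrightarrow> n dvd k" using assms by (intro complex_root_unity_eq_1) simp
  finally show ?thesis .
qed

lemma zeta_double_power2: "zeta (2 * n) ^ 2 = zeta n"
  unfolding zeta_def by (simp flip: exp_double add: field_simps)

lemma zeta_double_power:
  assumes "n > 0"
  shows "zeta (2 * n) ^ n = -1"
proof -
  have "(zeta (2 * n) ^ n) ^ 2 = 1"
    using zeta_power_eq_1_iff[of "2 * n" "n * 2"] assms by (simp add: power_mult mult.commute)
  moreover have "zeta (2 * n) ^ n \<noteq> 1"
    using zeta_power_eq_1_iff[of "2 * n" n] assms by (auto dest: dvd_imp_le)
  ultimately show ?thesis by (metis power2_eq_1_iff)
qed

lemma generate_minus_one_subset:
  assumes "a \<noteq> 0" and x: "x \<in> generate rat_units {-1, a}"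
  shows "\<exists>k. x = a powi k \<or> x = - (a powi k)"
proof -
  have inv: "inv\<^bsub>rat_units\<^esub> h = inverse h" if "h \<noteq> 0" for h :: rat
    unfolding m_inv_def
  proof (rule the_equality)
    show "y = inverse h" if "y \<in> carrier rat_units \<and> h \<otimes>\<^bsub>rat_units\<^esub> y = \<one>\<^bsub>rat_units\<^esub> \<and>
        y \<otimes>\<^bsub>rat_units\<^esub> h = \<one>\<^bsub>rat_units\<^esub>" for y
      using that by (auto simp: ring_of_type_algebra_def dest: inverse_unique)
  qed (use that in \<open>simp add: ring_of_type_algebra_def\<close>)
  show ?thesis using x
  proof (induction rule: generate.induct)
    case one
    then show ?case by (intro exI[of _ 0]) (simp add: ring_of_type_algebra_def)
  next
    case (incl h)
    then show ?case by (auto intro: exI[of _ 0] exI[of _ 1])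
  next
    case (inv h)
    then have "h \<noteq> 0" using assms by auto
    with inv show ?case
      by (auto simp: \<open>\<And>h. h \<noteq> 0 \<Longrightarrow> inv\<^bsub>rat_units\<^esub> h = inverse h\<close> power_int_minus
          intro: exI[of _ 0] exI[of _ "-1"])
  next
    case (eng h1 h2)
    then obtain k l where "h1 = a powi k \<or> h1 = - (a powi k)" "h2 = a powi l \<or> h2 = - (a powi l)"
      by blast
    then have "h1 * h2 = a powi (k + l) \<or> h1 * h2 = - (a powi (k + l))"
      using assms by (auto simp: power_int_add)
    then show ?case by (auto simp: ring_of_type_algebra_def)
  qed
qed

text \<open>With h' = h / gcd d h, \<alpha>^h' is a d-th root of a, and \<open>zeta (2 * d)\<close>
  is one of -1. These two account for all roots of group elements up to 2d-th roots of
  unity.\<close>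

lemma kummer_field_eq:
  fixes a a0 :: rat and h d :: nat
  assumes a0: "a0 > 0" and h: "h > 0" and a: "a = a0 ^ h" and d: "d > 0"
  defines "N \<equiv> d div gcd d h"
  assumes \<alpha>: "\<alpha> > 0" "\<alpha> ^ N = (of_rat a0 :: real)"
    and E: "subfield (CF.simple_extension (Qadj (zeta (2 * d))) (of_real \<alpha>)) complex_field"
  shows "kummer_field (generate rat_units {-1, a}) d =
    CF.simple_extension (Qadj (zeta (2 * d))) (of_real \<alpha>)"
proof -
  let ?z = "zeta (2 * d)" and ?\<Gamma> = "generate rat_units {-1, a}" and ?a = "of_real \<alpha> :: complex"
  let ?E = "CF.simple_extension (Qadj ?z) ?a"
  let ?G = "generate_field complex_field (insert (zeta d) (roots ?\<Gamma> d))"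
  have apos: "a > 0" using a0 a by simp
  obtain h' where h': "h = h' * gcd d h" "coprime h' N"
    and N: "d = N * gcd d h" "N > 0" "h' > 0"
  proof
    show "h = h div gcd d h * gcd d h" "d = N * gcd d h" by (simp_all add: N_def)
    show "coprime (h div gcd d h) N"
      using div_gcd_coprime[of h d] d unfolding N_def by (simp add: gcd.commute)
    show "N > 0" "h div gcd d h > 0" using d h by (simp_all add: N_def div_greater_zero_iff gcd_le1_nat gcd_le2_nat)
  qed
  have aN: "?a ^ N = of_rat a0" using \<alpha>(2) by (metis of_real_of_rat of_real_power)
  have ahd: "(?a ^ h') ^ d = of_rat a"
  proof -
    have "(?a ^ h') ^ d = (?a ^ N) ^ (h' * gcd d h)"
      by (subst N(1)) (simp add: mult_ac flip: power_mult)
    then show ?thesis using aN a h'(1) by (simp flip: of_rat_power)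
  qed
  have a_ne: "?a \<noteq> 0" using \<alpha>(1) by simp
  have G: "subfield ?G complex_field" by (rule field.generate_field_is_subfield[OF field_complex_field]) simp
  note Es = subfield_complexD[OF E] and Gs = subfield_complexD[OF G]
  have QE: "Qadj ?z \<subseteq> ?E" by (rule CF.simple_extension_incl) simp_all
  have zQ: "?z \<in> Qadj ?z" using ipoly_in_Qadj[of "monom 1 1" ?z] by (simp add: ipoly_monom)
  have prim: "?z ^ k = 1 \<longleftrightarrow> 2 * d dvd k" for k using zeta_power_eq_1_iff[of "2 * d"] d by simp
  have sub_Q: "subfield (Qadj ?z) complex_field" using cyclotomic_field(1)[OF prim] d by simp
  have aE: "?a \<in> ?E" by (rule CF.simple_extension_mem[OF subfieldE(1)[OF sub_Q]]) simp
  have "?G \<subseteq> ?E"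
  proof (rule field.generate_field_min_subfield1[OF field_complex_field _ E])
    show "insert (zeta d) (roots ?\<Gamma> d) \<subseteq> ?E"
    proof
      fix x assume "x \<in> insert (zeta d) (roots ?\<Gamma> d)"
      then consider "x = zeta d" | "x \<in> roots ?\<Gamma> d" by blast
      then show "x \<in> ?E"
      proof cases
        case 1
        then show ?thesis using Es(7)[of ?z 2] QE zQ zeta_double_power2[of d] by auto
      next
        case 2
        then obtain g where g: "g \<in> ?\<Gamma>" "x ^ d = of_rat g" by (auto simp: roots_def)
        obtain k where k: "g = a powi k \<or> g = - (a powi k)"
          using generate_minus_one_subset[OF _ g(1)] apos by auto
        let ?y = "(?a ^ h') powi k"
        have yd: "?y ^ d = of_rat (a powi k)"
        proof -
          have "?y ^ d = ((?a ^ h') ^ d) powi k"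
            by (simp add: power_int_def power_inverse flip: power_mult) (simp add: mult_ac)
          also have "\<dots> = of_rat (a powi k)"
            by (simp add: ahd power_int_def of_rat_power of_rat_inverse)
          finally show ?thesis .
        qed
        have yE: "?y \<in> ?E" using Es(6,7) aE by (auto simp: power_int_def)
        have y0: "?y \<noteq> 0" using a_ne by simp
        \<comment> \<open>Squaring removes the sign of g, so x and y differ by a 2d-th root of
          unity.\<close>
        have "(x ^ d) ^ 2 = (?y ^ d) ^ 2" using g(2) k yd by (auto simp: of_rat_minus)
        then have "x ^ (2 * d) = ?y ^ (2 * d)" by (simp add: mult.commute flip: power_mult)
        then have "(x / ?y) ^ (2 * d) = 1"
          unfolding power_divide using y0 by (metis divide_self power_not_zero)
        then obtain j where j: "x / ?y = ?z ^ j"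
          using primitive_root_powers(2)[OF prim] d by fastforce
        then have "x = ?z ^ j * ?y" using y0 by (simp add: field_simps)
        then show ?thesis using Es(5,7) yE zQ QE by auto
      qed
    qed
  qed simp
  moreover have "?E \<subseteq> ?G"
  proof (rule CF.simple_extension_subring_incl[OF subfieldE(1)[OF G]])
    have in_G: "x \<in> ?G" if "x ^ d \<in> of_rat ` ?\<Gamma>" for x
      using that by (intro generate_field.incl) (simp add: roots_def)
    have "-1 \<in> ?\<Gamma>" "a \<in> ?\<Gamma>" by (auto intro: generate.incl)
    moreover have "?z ^ d = of_rat (-1)" using zeta_double_power[OF d] by simp
    ultimately have zG: "?z \<in> ?G" and ahG: "?a ^ h' \<in> ?G"
      using ahd by (intro in_G; metis imageI)+
    show "Qadj ?z \<subseteq> ?G"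
      unfolding simple_extension_Rats[symmetric]
      by (rule CF.simple_extension_subring_incl[OF subfieldE(1)[OF G] Rats_subset_subfield[OF G] zG])
    \<comment> \<open>As h' is prime to N and \<alpha>^N = a0 is rational, \<alpha> itself is
      recovered from \<alpha>^h'.\<close>
    obtain x y where xy: "h' * x = N * y + 1"
      using bezout_nat[of h' N] h'(2) N(3) by (metis coprime_imp_gcd_eq_1 less_irrefl)
    have "(?a ^ h') ^ x = (?a ^ N) ^ y * ?a"
      by (simp add: xy flip: power_mult)
    then have "?a = (?a ^ h') ^ x * inverse ((?a ^ N) ^ y)" using a_ne by simp
    moreover have "?a ^ N \<in> ?G" using aN Rats_subset_subfield[OF G] by auto
    ultimately show "?a \<in> ?G" using Gs(5-7) ahG by metis
  qed
  ultimately show ?thesis unfolding kummer_field_def by blast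
qed

text \<open>The degree multiplies along the tower through the cyclotomic field. The numbers a0 and
  a1 differ by a rational square, so the criterion for square roots of squarefree integers applies
  to a0.\<close>

theorem kummer_field_degree:
  fixes a a0 a2 :: rat and a1 h d :: nat
  assumes a0: "a0 > 0" "\<nexists>(b::rat) n::nat. n \<ge> 2 \<and> a0 = b ^ n"
    and h: "h > 0" and a: "a = a0 ^ h" and a1: "squarefree a1" "a0 = of_nat a1 * a2\<^sup>2"
    and d: "d > 0"
  shows "ring.dim complex_field \<rat> (kummer_field (generate rat_units {-1, a}) d) =
    totient (2 * d) * (if even (d div gcd d h) \<and>
      (\<forall>p. prime p \<longrightarrow> p dvd a1 \<longrightarrow> p dvd 2 * d \<and> (p = 2 \<longrightarrow> 8 dvd 2 * d))
      then d div gcd d h div 2 else d div gcd d h)"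
proof -
  define N where "N = d div gcd d h"
  let ?z = "zeta (2 * d)"
  have N: "N > 0" "N dvd d" using d
    by (auto simp: N_def div_greater_zero_iff gcd_le1_nat intro: div_dvd_iff_mult[THEN iffD2])
  define \<alpha> where "\<alpha> = root N (of_rat a0)"
  have \<alpha>: "\<alpha> > 0" "\<alpha> ^ N = of_rat a0" using a0(1) N by (simp_all add: \<alpha>_def)
  have prim: "?z ^ k = 1 \<longleftrightarrow> 2 * d dvd k" for k using zeta_power_eq_1_iff[of "2 * d"] d by simp
  \<comment> \<open>The square root criterion is stated for the square of a root of unity of twice
    the order; here that root has order 4d.\<close>
  have prim4: "zeta (2 * (2 * d)) ^ k = 1 \<longleftrightarrow> 2 * (2 * d) dvd k" for k
    using zeta_power_eq_1_iff[of "2 * (2 * d)" k] d by simp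
  have n: "2 * d > 0" "2 * N dvd 2 * d" using d N by simp_all
  let ?K = "Qadj ?z"
  let ?c = "even N \<and> (\<exists>x\<in>?K. x ^ 2 = of_rat a0)"
  note deg = kummer_degree[OF prim n a0 \<alpha> N(1)]
  have K: "subfield ?K complex_field" and dK: "CF.dimension (totient (2 * d)) \<rat> ?K"
    using cyclotomic_field[OF prim n(1)] by auto
  note Ks = subfield_complexD[OF K]
  have a2: "a2 \<noteq> 0" using a0(1) a1(2) by auto
  have a2K: "of_rat a2 \<in> ?K" using Rats_subset_subfield[OF K] by auto
  have c_iff: "?c \<longleftrightarrow> even N \<and>
      (\<forall>p. prime p \<longrightarrow> p dvd a1 \<longrightarrow> p dvd 2 * d \<and> (p = 2 \<longrightarrow> 8 dvd 2 * d))"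
  proof (rule conj_cong[OF refl])
    assume "even N"
    then have "4 dvd 2 * d" using N(2) by (auto elim!: dvdE)
    note iff = sqrt_in_cyclotomic_iff[OF prim4 n(1) this a1(1), unfolded zeta_double_power2]
    have a0': "of_rat a0 = (of_nat a1 * of_rat a2 ^ 2 :: complex)"
      by (simp add: a1(2) of_rat_mult of_rat_power)
    have "(\<exists>x\<in>?K. x ^ 2 = of_rat a0) \<longleftrightarrow> (\<exists>x\<in>?K. x ^ 2 = of_nat a1)"
    proof
      assume "\<exists>x\<in>?K. x ^ 2 = of_rat a0"
      then obtain x where "x \<in> ?K" "x ^ 2 = of_rat a0" by blast
      then have "x * inverse (of_rat a2) \<in> ?K" "(x * inverse (of_rat a2)) ^ 2 = of_nat a1"
        using Ks a2K a2 by (auto simp: a0' power_mult_distrib power_inverse)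
      then show "\<exists>x\<in>?K. x ^ 2 = of_nat a1" by blast
    next
      assume "\<exists>x\<in>?K. x ^ 2 = of_nat a1"
      then obtain x where "x \<in> ?K" "x ^ 2 = of_nat a1" by blast
      then have "x * of_rat a2 \<in> ?K" "(x * of_rat a2) ^ 2 = of_rat a0"
        using Ks a2K by (auto simp: a0' power_mult_distrib)
      then show "\<exists>x\<in>?K. x ^ 2 = of_rat a0" by blast
    qed
    then show "(\<exists>x\<in>?K. x ^ 2 = of_rat a0) \<longleftrightarrow>
      (\<forall>p. prime p \<longrightarrow> p dvd a1 \<longrightarrow> p dvd 2 * d \<and> (p = 2 \<longrightarrow> 8 dvd 2 * d))"
      using iff by blast
  qed
  have "kummer_field (generate rat_units {-1, a}) d = CF.simple_extension ?K (of_real \<alpha>)"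
    using kummer_field_eq[OF a0(1) h a d \<alpha>(1) _ deg(1)] \<alpha>(2) by (simp add: N_def)
  moreover have "CF.dimension (totient (2 * d) * (if ?c then N div 2 else N)) \<rat>
      (CF.simple_extension ?K (of_real \<alpha>))"
    by (rule CF.telescopic_base[OF subfield_Rats K dK deg(2)])
  ultimately have "CF.dim \<rat> (kummer_field (generate rat_units {-1, a}) d)
      = totient (2 * d) * (if ?c then N div 2 else N)"
    using CF.dimI[OF subfield_Rats] by (simp add: over_def)
  then show ?thesis unfolding c_iff unfolding N_def .
qed

section \<open>Sums over squarefree numbers\<close>

lemma squarefree_prod_primes:
  assumes "finite S" "\<And>p. p \<in> S \<Longrightarrow> prime (p :: nat)"
  shows "prime_factors (\<Prod>S) = S" "squarefree (\<Prod>S)"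
proof -
  show "prime_factors (\<Prod>S) = S"
  proof -
    have "prime_factorization (\<Prod>S) = (\<Sum>p\<in>S. prime_factorization p)"
      using assms by (intro prime_factorization_prod) (auto intro: prime_gt_0_nat)
    also have "\<dots> = (\<Sum>p\<in>S. {#p#})"
      using assms(2) by (intro sum.cong) (auto simp: prime_factorization_prime)
    also have "set_mset \<dots> = S" using assms(1) by (simp add: set_mset_sum)
    finally show ?thesis .
  qed
  have "coprime p q" if "p \<in> S" "q \<in> S" "p \<noteq> q" for p q
    using that assms(2) by (intro primes_coprime) auto
  then show "squarefree (\<Prod>S)"
    using assms(2) by (intro squarefree_prod_coprime) (auto intro: squarefree_prime)
qed

lemma prod_prime_factors_squarefree:
  assumes "squarefree (k :: nat)"
  shows "\<Prod>(prime_factors k) = k"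
proof -
  have k: "k \<noteq> 0" using assms by (metis not_squarefree_0)
  have "k = (\<Prod>p\<in>prime_factors k. p ^ multiplicity p k)"
    using prime_factorization_nat[of k] k by simp
  also have "\<dots> = \<Prod>(prime_factors k)"
    using assms k by (intro prod.cong) (auto simp: squarefree_factorial_semiring')
  finally show ?thesis by simp
qed

text \<open>For a set Q of primes, the multiplicative function with values t at primes, restricted
  to squarefree multiples of the product of Q. The Moebius sign is meant to be absorbed into
  t.\<close>

definition squarefree_prod :: "nat set \<Rightarrow> (nat \<Rightarrow> real) \<Rightarrow> nat \<Rightarrow> real" where
  "squarefree_prod Q t k =
    (if squarefree k \<and> Q \<subseteq> prime_factors k then \<Prod>p\<in>prime_factors k. t p else 0)"

text \<open>Squarefree numbers with prime factors in P correspond to subsets of P, over which a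
  product of binomials expands. For p in Q the choice of leaving p out is given weight 0 instead of
  1.\<close>

lemma sum_squarefree_prod:
  assumes P: "finite P" "\<And>p. p \<in> P \<Longrightarrow> prime p" and Q: "Q \<subseteq> P"
  shows "(\<Sum>k\<in>(\<lambda>S. \<Prod>S) ` Pow P. squarefree_prod Q t k) = (\<Prod>p\<in>P. if p \<in> Q then t p else 1 + t p)"
proof -
  have S: "prime_factors (\<Prod>S) = S" "squarefree (\<Prod>S)" "finite S" if "S \<in> Pow P" for S
    using squarefree_prod_primes[of S] that P finite_subset[of S P] by auto
  have "inj_on (\<lambda>S. \<Prod>S) (Pow P)" using S(1) by (metis inj_onI)
  then have "(\<Sum>k\<in>(\<lambda>S. \<Prod>S) ` Pow P. squarefree_prod Q t k)
      = (\<Sum>S\<in>Pow P. squarefree_prod Q t (\<Prod>S))" by (simp add: sum.reindex)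
  also have "\<dots> = (\<Sum>S\<in>Pow P. (\<Prod>p\<in>S. t p) * (\<Prod>p\<in>P-S. if p \<in> Q then 0 else 1))"
  proof (rule sum.cong)
    fix S assume "S \<in> Pow P"
    note S = S[OF this]
    have "(\<Prod>p\<in>P-S. if p \<in> Q then 0 else 1 :: real) = (if Q \<subseteq> S then 1 else 0)"
      using P(1) Q by (auto intro!: prod.neutral)
    then show "squarefree_prod Q t (\<Prod>S) = (\<Prod>p\<in>S. t p) * (\<Prod>p\<in>P-S. if p \<in> Q then 0 else 1)"
      using S by (simp add: squarefree_prod_def)
  qed simp
  also have "\<dots> = (\<Prod>p\<in>P. t p + (if p \<in> Q then 0 else 1))"
    by (rule prod_add[OF P(1), symmetric])
  also have "\<dots> = (\<Prod>p\<in>P. if p \<in> Q then t p else 1 + t p)"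
    by (rule prod.cong) auto
  finally show ?thesis .
qed

lemma squarefree_atMost_subset:
  assumes "k \<le> x" "squarefree k"
  shows "k \<in> (\<lambda>S. \<Prod>S) ` Pow {p. prime p \<and> p \<le> (x :: nat)}"
proof
  show "k = \<Prod>(prime_factors k)" using prod_prime_factors_squarefree[OF assms(2)] by simp
  have "k > 0" using assms(2) by (metis not_squarefree_0 neq0_conv)
  then show "prime_factors k \<in> Pow {p. prime p \<and> p \<le> x}"
    using assms(1) by (auto simp: prime_factors_dvd dest: dvd_imp_le)
qed

lemma finite_primes_atMost: "finite {p. prime p \<and> p \<le> (x :: nat)}"
  by (rule finite_subset[of _ "{..x}"]) auto

text \<open>Partial products sum over numbers with bounded prime factors, partial sums over initial
  segments. Absolute convergence reconciles the two orders; it holds because the product of 1 + |t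
  p| is at most the exponential of the sum of |t p|.\<close>

theorem squarefree_euler_product:
  fixes t :: "nat \<Rightarrow> real" and Q :: "nat set"
  assumes t: "summable (\<lambda>p. if prime p then \<bar>t p\<bar> else 0)"
    and Q: "finite Q" "\<And>p. p \<in> Q \<Longrightarrow> prime p"
  defines "u \<equiv> \<lambda>p. if prime p then if p \<in> Q then t p else 1 + t p else 1"
  shows "convergent_prod u" "squarefree_prod Q t sums prodinf u"
proof -
  let ?P = "\<lambda>x. {p. prime p \<and> p \<le> (x :: nat)}"
  let ?A = "\<lambda>x. (\<lambda>S. \<Prod>S) ` Pow (?P x)"
  let ?F = "squarefree_prod Q t"
  obtain q0 where q0: "Q \<subseteq> {..q0}" using Q(1) finite_nat_iff_bounded_le by blast
  have "summable (\<lambda>p. norm (u p - 1))"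
  proof (rule summable_comparison_test_ev[OF _ t])
    show "\<forall>\<^sub>F p in sequentially. norm (norm (u p - 1)) \<le> (if prime p then \<bar>t p\<bar> else 0)"
      using eventually_gt_at_top[of q0] by eventually_elim (use q0 in \<open>auto simp: u_def\<close>)
  qed
  then have "abs_convergent_prod u" by (simp add: abs_convergent_prod_conv_summable)
  then show conv: "convergent_prod u" by (rule abs_convergent_prod_imp_convergent_prod)
  have sub: "sum f {..x} \<le> sum f (?A x)" if "\<And>k. f k \<ge> 0" "\<And>k. \<not> squarefree k \<Longrightarrow> f k = 0"
    for f :: "nat \<Rightarrow> real" and x
  proof -
    have "sum f {..x} = sum f {k\<in>{..x}. squarefree k}"
    proof (rule sum.mono_neutral_right)
      show "\<forall>k\<in>{..x} - {k\<in>{..x}. squarefree k}. f k = 0" using that(2) by simp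
    qed auto
    also have "\<dots> \<le> sum f (?A x)"
    proof (rule sum_mono2)
      show "{k\<in>{..x}. squarefree k} \<subseteq> ?A x" using squarefree_atMost_subset by blast
      show "finite (?A x)" using finite_primes_atMost by simp
    qed (use that(1) in simp)
    finally show ?thesis .
  qed
  let ?G = "squarefree_prod {} (\<lambda>p. \<bar>t p\<bar>)"
  have G: "?G k \<ge> 0" "\<not> squarefree k \<Longrightarrow> ?G k = 0" "\<bar>?F k\<bar> \<le> ?G k" for k
    by (auto simp: squarefree_prod_def abs_prod intro: prod_nonneg)
  have "summable ?G"
  proof (rule bounded_imp_summable)
    show "?G k \<ge> 0" for k by (rule G)
    fix x
    have "sum ?G {..x} \<le> sum ?G (?A x)" using G by (intro sub)
    also have "\<dots> = (\<Prod>p\<in>?P x. 1 + \<bar>t p\<bar>)"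
    proof -
      have "sum ?G (?A x) = (\<Prod>p\<in>?P x. if p \<in> {} then \<bar>t p\<bar> else 1 + \<bar>t p\<bar>)"
        by (rule sum_squarefree_prod[OF finite_primes_atMost]) blast+
      then show ?thesis by (simp only: empty_iff if_False)
    qed
    also have "\<dots> \<le> (\<Prod>p\<in>?P x. exp \<bar>t p\<bar>)" by (intro prod_mono) auto
    also have "\<dots> = exp (\<Sum>p\<in>?P x. \<bar>t p\<bar>)" by (rule exp_sum[symmetric, OF finite_primes_atMost])
    also have "(\<Sum>p\<in>?P x. \<bar>t p\<bar>) = (\<Sum>p\<le>x. if prime p then \<bar>t p\<bar> else 0)"
      by (rule sum.mono_neutral_cong_left) auto
    also have "exp \<dots> \<le> exp (\<Sum>p. if prime p then \<bar>t p\<bar> else 0)"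
      using t by (simp add: sum_le_suminf)
    finally show "sum ?G {..x} \<le> exp (\<Sum>p. if prime p then \<bar>t p\<bar> else 0)" .
  qed
  then have nsum: "summable (\<lambda>k. norm (?F k))"
    by (rule summable_comparison_test'[where N = 0]) (use G(3) in simp)
  then have summ: "summable ?F" by (rule summable_norm_cancel)
  have hs: "(?F has_sum suminf ?F) UNIV"
    by (rule norm_summable_imp_has_sum[OF nsum summable_sums[OF summ]])
  \<comment> \<open>The sets \<open>?A x\<close> contain only squarefree numbers and do not exhaust
    the naturals. Adding the initial segment does, and adds only vanishing terms.\<close>
  let ?B = "\<lambda>x. {..x} \<union> ?A x"
  have "filterlim ?B (finite_subsets_at_top UNIV) sequentially"
    unfolding filterlim_finite_subsets_at_top
  proof safe
    fix Y :: "nat set" assume "finite Y"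
    then obtain x0 where "Y \<subseteq> {..x0}" using finite_nat_iff_bounded_le by blast
    then have x0: "Y \<subseteq> {..x0}" .
    have fin: "finite (?B x)" for x using finite_primes_atMost by simp
    have "Y \<subseteq> ?B x" if "x \<ge> x0" for x
    proof -
      have "{..x0} \<subseteq> {..x}" using that by simp
      with x0 have "Y \<subseteq> {..x}" by (rule subset_trans)
      then show ?thesis by (rule le_supI1)
    qed
    then show "\<forall>\<^sub>F x in sequentially. finite (?B x) \<and> Y \<subseteq> ?B x \<and> ?B x \<subseteq> UNIV"
      using fin unfolding eventually_sequentially by blast
  qed
  then have "(\<lambda>x. sum ?F (?B x)) \<longlonglongrightarrow> suminf ?F"
    by (rule filterlim_compose[OF hs[unfolded has_sum_def]])
  moreover have "\<forall>\<^sub>F x in sequentially. sum ?F (?B x) = (\<Prod>p\<le>x. u p)"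
    using eventually_ge_at_top[of q0]
  proof eventually_elim
    case (elim x)
    have "sum ?F (?B x) = sum ?F (?A x)"
    proof (rule sum.mono_neutral_right)
      show "\<forall>k\<in>?B x - ?A x. ?F k = 0"
        using squarefree_atMost_subset[of _ x] by (fastforce simp: squarefree_prod_def)
    qed (use finite_primes_atMost in auto)
    also have "\<dots> = (\<Prod>p\<in>?P x. if p \<in> Q then t p else 1 + t p)"
      using elim q0 Q by (intro sum_squarefree_prod finite_primes_atMost) auto
    also have "\<dots> = (\<Prod>p\<le>x. u p)"
      by (rule prod.mono_neutral_cong_left) (auto simp: u_def)
    finally show ?case .
  qed
  ultimately have "(\<lambda>x. \<Prod>p\<le>x. u p) \<longlonglongrightarrow> suminf ?F" by (rule Lim_transform_eventually)
  moreover have "(\<lambda>x. \<Prod>p\<le>x. u p) \<longlonglongrightarrow> prodinf u" by (rule convergent_prod_LIMSEQ[OF conv])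
  ultimately have "suminf ?F = prodinf u" by (rule LIMSEQ_unique)
  then show "?F sums prodinf u" using summable_sums[OF summ] by simp
qed

text \<open>Serves both to force the primes of Q and to compare with the product for Artin's
  constant.\<close>

lemma prodinf_finite_change:
  fixes f g :: "nat \<Rightarrow> real"
  assumes f: "convergent_prod f" and D: "finite D" "\<And>p. p \<notin> D \<Longrightarrow> g p = f p"
    and nz: "\<And>p. p \<in> D \<Longrightarrow> f p \<noteq> 0"
  shows "prodinf g = (\<Prod>p\<in>D. g p / f p) * prodinf f"
proof -
  let ?r = "\<lambda>p. if p \<in> D then g p / f p else 1"
  have r: "convergent_prod ?r" by (rule convergent_prod_finite[OF D(1)]) simp
  have "prodinf ?r * prodinf f = (\<Prod>p. ?r p * f p)" by (rule prodinf_mult[OF r f])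
  also have "(\<lambda>p. ?r p * f p) = g" using D(2) nz by auto
  finally have "prodinf g = prodinf ?r * prodinf f" by simp
  also have "prodinf ?r = (\<Prod>p\<in>D. ?r p)" by (rule prodinf_finite[OF D(1)]) simp
  finally show ?thesis by simp
qed

section \<open>The sum of the reciprocal degrees\<close>

lemma prime_multiplicity_mult:
  fixes l d k :: nat
  assumes "prime l" "d > 0" "k > 0"
  shows "multiplicity l (d * k) = multiplicity l d + multiplicity l k"
  using assms by (intro prime_elem_multiplicity_mult_distrib) auto

lemma multiplicity_gcd_nat:
  fixes l d h :: nat
  assumes "d > 0" "h > 0" "prime l"
  shows "multiplicity l (gcd d h) = min (multiplicity l d) (multiplicity l h)"
  using assms by (intro multiplicity_gcd) auto

lemma prime_dvd_div_gcd_iff: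
  fixes l d h :: nat
  assumes "d > 0" "h > 0" "prime l"
  shows "l dvd d div gcd d h \<longleftrightarrow> multiplicity l h < multiplicity l d"
proof -
  let ?q = "d div gcd d h"
  have q: "d = gcd d h * ?q" "?q > 0" "gcd d h > 0"
    using assms by (simp_all add: div_greater_zero_iff gcd_le1_nat)
  have "multiplicity l d = multiplicity l (gcd d h) + multiplicity l ?q"
    using prime_multiplicity_mult[OF assms(3) q(3,2)] q(1) by simp
  moreover have "l dvd ?q \<longleftrightarrow> multiplicity l ?q > 0"
    using q(2) assms(3) by (metis neq0_conv prime_elem_multiplicity_eq_zero_iff prime_imp_prime_elem)
  ultimately show ?thesis using multiplicity_gcd_nat[OF assms] by auto
qed

lemma gcd_mult_prime:
  fixes l d h :: nat
  assumes "d > 0" "h > 0" "prime l"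
  shows "gcd (d * l) h = gcd d h * (if multiplicity l d < multiplicity l h then l else 1)"
proof -
  let ?g = "gcd d h"
  have g: "d = ?g * (d div ?g)" "h = ?g * (h div ?g)" by simp_all
  have "gcd (d * l) h = gcd (?g * (d div ?g * l)) (?g * (h div ?g))"
    using g by (metis mult.assoc)
  also have "\<dots> = ?g * gcd (d div ?g * l) (h div ?g)" by (simp only: gcd_mult_distrib_nat)
  also have "gcd (d div ?g * l) (h div ?g) = gcd l (h div ?g)"
  proof (rule gcd_mult_left_left_cancel)
    show "coprime (h div ?g) (d div ?g)"
      using div_gcd_coprime[of d h] assms(1) by (metis coprime_commute neq0_conv)
  qed
  also have "\<dots> = (if l dvd h div ?g then l else 1)"
    using assms(3) by (auto simp: gcd_nat.absorb1 prime_imp_coprime coprime_iff_gcd_eq_1[symmetric])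
  also have "l dvd h div ?g \<longleftrightarrow> multiplicity l d < multiplicity l h"
    using prime_dvd_div_gcd_iff[OF assms(2,1,3)] by (simp add: gcd.commute)
  finally show ?thesis .
qed

lemma totient_mult_prime:
  fixes l n :: nat
  assumes "prime l"
  shows "totient (n * l) = totient n * (if l dvd n then l else l - 1)"
proof (cases "l dvd n")
  case True
  have l: "totient l > 0" using assms prime_gt_0_nat by simp
  have "totient (n * l) * totient (gcd n l) = totient n * totient l * gcd n l" by (rule totient_gcd)
  moreover have "gcd n l = l" using True by (simp add: gcd_nat.absorb2)
  ultimately have "totient (n * l) * totient l = (totient n * l) * totient l"
    by (metis mult.assoc mult.commute)
  then have "totient (n * l) = totient n * l" using l by (metis mult_cancel2 neq0_conv)
  then show ?thesis using True by (simp only: if_True)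
next
  case False
  then have "coprime n l" using assms by (metis coprime_commute prime_imp_coprime)
  then show ?thesis using False assms by (simp add: totient_mult_coprime totient_prime)
qed

text \<open>The reciprocal of the degree of level \<open>d\<close> when \<open>\<surd>a\<^sub>1\<close> does not lower it.\<close>

definition weight :: "nat \<Rightarrow> nat \<Rightarrow> real" where
  "weight h d = real (gcd d h) / (real (totient (2 * d)) * real d)"

text \<open>The quotient of \<open>weight h (d * l)\<close> by \<open>weight h d\<close> for a prime
  l: the numerator is the growth of the gcd, the denominator that of d and of the totient.\<close>

definition local_ratio :: "nat \<Rightarrow> nat \<Rightarrow> nat \<Rightarrow> real" where
  "local_ratio h d l = (if multiplicity l d < multiplicity l h then real l else 1) /
    (real l * (if l dvd 2 * d then real l else real l - 1))"

lemma weight_mult_prime: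
  assumes "d > 0" "h > 0" "prime l"
  shows "weight h (d * l) = weight h d * local_ratio h d l"
proof -
  have "totient (2 * (d * l)) = totient (2 * d) * (if l dvd 2 * d then l else l - 1)"
    using totient_mult_prime[OF assms(3), of "2 * d"] by (simp only: mult.assoc)
  moreover have "real (l - 1) = real l - 1" using prime_gt_0_nat[OF assms(3)] by simp
  ultimately show ?thesis
    unfolding weight_def local_ratio_def gcd_mult_prime[OF assms] by simp
qed

text \<open>The ratio at l sees only the power of l in the level, so multiplying in the other primes
  of k first does not change it.\<close>

lemma weight_mult_squarefree:
  assumes "m > 0" "h > 0" "squarefree k"
  shows "weight h (m * k) = weight h m * (\<Prod>p\<in>prime_factors k. local_ratio h m p)"
proof -
  have "weight h (m * \<Prod>S) = weight h m * (\<Prod>p\<in>S. local_ratio h m p)"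
    if "finite S" "\<And>p. p \<in> S \<Longrightarrow> prime p" for S
    using that
  proof (induction S rule: finite_induct)
    case (insert l S)
    have l: "prime l" using insert.prems by simp
    have P: "\<Prod>S > 0" using insert.prems by (intro prod_pos) (auto intro: prime_gt_0_nat)
    have "\<not> l dvd \<Prod>S"
    proof
      assume "l dvd \<Prod>S"
      then have "l \<in> prime_factors (\<Prod>S)" using l P by (simp add: prime_factors_dvd)
      then show False using squarefree_prod_primes(1)[of S] insert by auto
    qed
    then have "multiplicity l (\<Prod>S) = 0" by (rule not_dvd_imp_multiplicity_0)
    then have 1: "multiplicity l (m * \<Prod>S) = multiplicity l m"
      using prime_multiplicity_mult[OF l assms(1) P] by simp
    have 2: "l dvd 2 * (m * \<Prod>S) \<longleftrightarrow> l dvd 2 * m"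
      using \<open>\<not> l dvd \<Prod>S\<close> l by (simp add: prime_dvd_mult_iff)
    have "weight h (m * \<Prod>(insert l S)) = weight h (m * \<Prod>S * l)"
      using insert.hyps by (simp add: mult_ac)
    also have "\<dots> = weight h (m * \<Prod>S) * local_ratio h (m * \<Prod>S) l"
      using assms P l by (intro weight_mult_prime) auto
    also have "local_ratio h (m * \<Prod>S) l = local_ratio h m l"
      unfolding local_ratio_def 1 2 ..
    also have "weight h (m * \<Prod>S) = weight h m * (\<Prod>p\<in>S. local_ratio h m p)"
      using insert by simp
    finally show ?case using insert.hyps by (simp add: mult_ac)
  qed simp
  from this[of "prime_factors k"] show ?thesis
    using prod_prime_factors_squarefree[OF assms(3)] by auto
qed

lemma summable_prime_bound:
  assumes "\<forall>\<^sub>F p in sequentially. prime p \<longrightarrow> \<bar>t p\<bar> \<le> 2 / (real p)\<^sup>2"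
  shows "summable (\<lambda>p. if prime p then \<bar>t p\<bar> else (0 :: real))"
proof (rule summable_comparison_test_ev)
  show "\<forall>\<^sub>F p in sequentially. norm (if prime p then \<bar>t p\<bar> else 0) \<le> 2 * inverse (real p ^ 2)"
    using assms by eventually_elim (auto simp: divide_inverse)
  show "summable (\<lambda>p. 2 * inverse (real p ^ 2))"
    by (intro summable_mult inverse_power_summable) simp
qed

lemma inverse_square_diff_bound:
  assumes "prime p"
  shows "0 < 1 / ((real p)\<^sup>2 - real p)" "1 / ((real p)\<^sup>2 - real p) \<le> 1 / 2"
    "1 / ((real p)\<^sup>2 - real p) \<le> 2 / (real p)\<^sup>2"
proof -
  have p: "real p \<ge> 2" using prime_ge_2_nat[OF assms] by simp
  have eq: "(real p)\<^sup>2 - real p = real p * (real p - 1)" by (simp add: power2_eq_square algebra_simps)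
  have "real p * (real p - 1) \<ge> 2 * 1" using p by (intro mult_mono) auto
  then show "0 < 1 / ((real p)\<^sup>2 - real p)" "1 / ((real p)\<^sup>2 - real p) \<le> 1 / 2"
    unfolding eq by (auto intro!: divide_left_mono simp: field_simps)
  have "real p * (real p - 1) \<ge> real p * (real p / 2)" using p by (intro mult_left_mono) auto
  then have "1 / (real p * (real p - 1)) \<le> 1 / (real p * (real p / 2))"
    using p by (intro divide_left_mono mult_pos_pos) auto
  then show "1 / ((real p)\<^sup>2 - real p) \<le> 2 / (real p)\<^sup>2"
    unfolding eq by (simp add: power2_eq_square)
qed

lemma tau_cases: "tau h a1 m = 0 \<or> tau h a1 m = - 1 / 3 \<or> tau h a1 m = 1"
  by (simp add: tau_def Let_def)

text \<open>The reduced fraction x / y satisfies m y = x h, and comparing multiplicities in this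
  equation avoids computing x and y.\<close>

lemma val_of_nat_div_nonneg_iff:
  assumes "m > 0" "h > 0" "prime l"
  shows "val l (of_nat m / of_nat h) \<ge> 0 \<longleftrightarrow> multiplicity l h \<le> multiplicity l m"
proof -
  obtain x y where xy: "quotient_of (of_nat m / of_nat h) = (x, y)"
    by (cases "quotient_of (of_nat m / of_nat h)")
  have y: "y > 0" using quotient_of_denom_pos[OF xy] .
  have eq: "(of_nat m / of_nat h :: rat) = of_int x / of_int y" using quotient_of_div[OF xy] .
  then have "of_int x / of_int y > (0 :: rat)" using assms by (metis divide_pos_pos of_nat_0_less_iff)
  then have x: "x > 0" using y by (simp add: zero_less_divide_iff)
  have "of_int (int m * y) = (of_int (x * int h) :: rat)"
    using eq y assms by (simp add: field_simps)
  then have eq': "int m * y = x * int h" by (simp only: of_int_eq_iff)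
  obtain x' y' where xy': "x = int x'" "y = int y'" "x' > 0" "y' > 0"
    using x y by (metis zero_less_imp_eq_int)
  have "m * y' = x' * h" using eq' xy' by (metis of_nat_eq_iff of_nat_mult)
  then have "multiplicity l m + multiplicity l y' = multiplicity l x' + multiplicity l h"
    using prime_multiplicity_mult[OF assms(3)] assms xy' by metis
  moreover have "multiplicity (int l) (int n) = multiplicity l n" for n
  proof (cases "n = 0")
    case False
    show ?thesis
    proof (rule multiplicity_eqI)
      show "int l ^ multiplicity l n dvd int n"
        using multiplicity_dvd[of l n] by (metis of_nat_dvd_iff of_nat_power)
      have "\<not> l ^ Suc (multiplicity l n) dvd n"
        using False power_dvd_iff_le_multiplicity[of n l "Suc (multiplicity l n)"]
          prime_gt_1_nat[OF assms(3)] by simp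
      then show "\<not> int l ^ Suc (multiplicity l n) dvd int n" by (metis of_nat_dvd_iff of_nat_power)
    qed
  qed simp
  ultimately show ?thesis by (simp add: val_def xy xy') linarith
qed

text \<open>Here b stands for k being even, so the sums are the 2-adic valuation of mk for
  squarefree k. The left side is the 2-adic part of the condition for a smaller degree: it can never
  hold, hold only for even k, or always hold, and these are the three values of
  \<open>tau\<close>.\<close>

lemma tau_multiplicity:
  fixes h m a1 :: nat
  assumes "h > 0"
  shows "(multiplicity 2 h < multiplicity 2 m + (if b then 1 else 0) \<and>
      (even a1 \<longrightarrow> 2 \<le> multiplicity 2 m + (if b then 1 else 0 :: nat))) \<longleftrightarrow>
    tau h a1 m \<noteq> 0 \<and> (tau h a1 m = - 1 / 3 \<longrightarrow> b)"
proof -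
  have "even h \<longleftrightarrow> multiplicity 2 h > 0"
    using assms by (metis neq0_conv prime_elem_multiplicity_eq_zero_iff prime_imp_prime_elem two_is_prime_nat)
  then show ?thesis
    unfolding tau_def Let_def even_mult_iff
    by (cases "multiplicity 2 h"; cases "multiplicity 2 m"; cases b) auto
qed

lemma tau_minus_third_multiplicity:
  assumes "tau h a1 m = - 1 / 3"
  shows "multiplicity 2 h \<le> multiplicity 2 m"
  using assms unfolding tau_eq_minus_third_iff by auto

text \<open>Odd primes of a1 dividing m meet the condition for every k, the others have to divide k,
  and what happens at 2 is recorded by \<open>tau\<close>. So the levels of smaller degree are given
  by the multiples of one squarefree number, or there are none.\<close>

lemma entanglement_condition:
  fixes h m a1 k :: nat
  assumes m: "m > 0" and h: "h > 0" and k: "squarefree k"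
  defines "d \<equiv> m * k"
  shows "even (d div gcd d h) \<and>
      (\<forall>p. prime p \<longrightarrow> p dvd a1 \<longrightarrow> p dvd 2 * d \<and> (p = 2 \<longrightarrow> 8 dvd 2 * d)) \<longleftrightarrow>
    tau h a1 m \<noteq> 0 \<and>
      {p. prime p \<and> p dvd a1 \<and> \<not> p dvd 2 * m} \<union> (if tau h a1 m = - 1 / 3 then {2} else {})
        \<subseteq> prime_factors k"
proof -
  have k0: "k > 0" using k by (metis not_squarefree_0 neq0_conv)
  have d0: "d > 0" using m k0 by (simp add: d_def)
  have pf: "p \<in> prime_factors k \<longleftrightarrow> prime p \<and> p dvd k" for p
    using k0 by (auto simp: prime_factors_dvd)
  have mk: "multiplicity 2 k = (if even k then 1 else 0)"
    using k k0 pf[of 2] by (auto simp: squarefree_factorial_semiring' not_dvd_imp_multiplicity_0)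
  have md: "multiplicity 2 d = multiplicity 2 m + (if even k then 1 else 0)"
    unfolding d_def prime_multiplicity_mult[OF two_is_prime_nat m k0] mk ..
  have 1: "even (d div gcd d h) \<longleftrightarrow> multiplicity 2 h < multiplicity 2 d"
    by (rule prime_dvd_div_gcd_iff[OF d0 h two_is_prime_nat])
  have 2: "8 dvd 2 * d \<longleftrightarrow> 2 \<le> multiplicity 2 d"
  proof -
    have "8 dvd 2 * d \<longleftrightarrow> 2 * 2 ^ 2 dvd 2 * d" by simp
    also have "\<dots> \<longleftrightarrow> 2 ^ 2 dvd d" by (rule nat_mult_dvd_cancel1) simp
    also have "\<dots> \<longleftrightarrow> 2 \<le> multiplicity 2 d"
      using d0 by (intro power_dvd_iff_le_multiplicity) auto
    finally show ?thesis .
  qed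
  have 3: "(\<forall>p. prime p \<longrightarrow> p dvd a1 \<longrightarrow> p dvd 2 * d \<and> (p = 2 \<longrightarrow> 8 dvd 2 * d)) \<longleftrightarrow>
      (even a1 \<longrightarrow> 2 \<le> multiplicity 2 d) \<and>
      {p. prime p \<and> p dvd a1 \<and> \<not> p dvd 2 * m} \<subseteq> prime_factors k"
  proof (intro iffI conjI allI impI subsetI)
    assume *: "\<forall>p. prime p \<longrightarrow> p dvd a1 \<longrightarrow> p dvd 2 * d \<and> (p = 2 \<longrightarrow> 8 dvd 2 * d)"
    show "2 \<le> multiplicity 2 d" if "even a1"
    proof -
      have "8 dvd 2 * d" using * that two_is_prime_nat by blast
      then show ?thesis using 2 by blast
    qed
    fix p assume "p \<in> {p. prime p \<and> p dvd a1 \<and> \<not> p dvd 2 * m}"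
    then have p: "prime p" "p dvd a1" "\<not> p dvd 2 * m" by auto
    have "p dvd 2 * m * k" using * p by (simp add: d_def mult_ac)
    then show "p \<in> prime_factors k" using p pf prime_dvd_mult_iff[OF p(1)] by blast
  next
    fix p :: nat
    assume *: "(even a1 \<longrightarrow> 2 \<le> multiplicity 2 d) \<and>
      {p. prime p \<and> p dvd a1 \<and> \<not> p dvd 2 * m} \<subseteq> prime_factors k" and p: "prime p" "p dvd a1"
    have "p dvd 2 * m \<or> p dvd k" using * p pf by blast
    then show "p dvd 2 * d" unfolding d_def by (metis dvd_mult dvd_mult2 mult.assoc)
    show "8 dvd 2 * d" if "p = 2" using * p(2) that 2 by blast
  qed
  have "even (d div gcd d h) \<and>
      (\<forall>p. prime p \<longrightarrow> p dvd a1 \<longrightarrow> p dvd 2 * d \<and> (p = 2 \<longrightarrow> 8 dvd 2 * d)) \<longleftrightarrow>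
      (multiplicity 2 h < multiplicity 2 d \<and> (even a1 \<longrightarrow> 2 \<le> multiplicity 2 d)) \<and>
      {p. prime p \<and> p dvd a1 \<and> \<not> p dvd 2 * m} \<subseteq> prime_factors k"
    unfolding 1 3 by (simp only: conj_assoc)
  also have "\<dots> \<longleftrightarrow> (tau h a1 m \<noteq> 0 \<and> (tau h a1 m = - 1 / 3 \<longrightarrow> even k)) \<and>
      {p. prime p \<and> p dvd a1 \<and> \<not> p dvd 2 * m} \<subseteq> prime_factors k"
    unfolding md tau_multiplicity[OF h] ..
  also have "\<dots> \<longleftrightarrow> tau h a1 m \<noteq> 0 \<and>
      {p. prime p \<and> p dvd a1 \<and> \<not> p dvd 2 * m} \<union> (if tau h a1 m = - 1 / 3 then {2} else {})
        \<subseteq> prime_factors k"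
    using pf[of 2] by auto
  finally show ?thesis .
qed

text \<open>Positivity of 1 - ratio allows dividing by the Euler factors. For l not dividing 2m the
  ratio is at most 1 / (l - 1), which would reach 1 only at l = 2, excluded since 2 divides
  2m.\<close>

lemma local_ratio_pos:
  assumes "prime l"
  shows "local_ratio h m l > 0" "1 - local_ratio h m l > 0"
proof -
  have l: "real l \<ge> 2" using prime_ge_2_nat[OF assms] by simp
  then show "local_ratio h m l > 0" by (auto simp: local_ratio_def)
  show "1 - local_ratio h m l > 0"
  proof (cases "l dvd 2 * m")
    case True
    have "real l * real l \<ge> 2 * real l" using l by (intro mult_right_mono) auto
    then have "real l * real l > 1" using l by linarith
    then show ?thesis using True l by (auto simp: local_ratio_def field_simps)
  next
    case False
    then have "l \<noteq> 2" by auto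
    then have "real l \<ge> 3" using prime_ge_2_nat[OF assms] by simp
    then have "real l * 3 \<le> real l * real l" by (intro mult_left_mono) auto
    then have "1 + real l < real l * real l" using \<open>real l \<ge> 3\<close> by linarith
    then show ?thesis using False \<open>real l \<ge> 3\<close> by (auto simp: local_ratio_def field_simps)
  qed
qed

lemma local_ratio_unramified:
  assumes "prime l" "\<not> l dvd 2 * m" "h > 0"
  shows "local_ratio h m l = real (gcd l h) / ((real l)\<^sup>2 - real l)"
proof -
  have "\<not> l dvd m" using assms(2) by auto
  then have "multiplicity l m = 0" by (rule not_dvd_imp_multiplicity_0)
  moreover have "multiplicity l h > 0 \<longleftrightarrow> l dvd h"
    using assms by (metis neq0_conv prime_elem_multiplicity_eq_zero_iff prime_imp_prime_elem)
  moreover have "gcd l h = (if l dvd h then l else 1)"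
    using assms(1) by (auto simp: gcd_nat.absorb1 prime_imp_coprime coprime_iff_gcd_eq_1[symmetric])
  ultimately show ?thesis using assms(2)
    by (simp add: local_ratio_def power2_eq_square algebra_simps)
qed

text \<open>The products of u and v are the Euler products of the full and the restricted sum. They
  differ only at Q, by factors t / (1 + t), and u differs from Artin's product only at the primes
  dividing 2m or h.\<close>

theorem sums_reciprocal_degrees:
  fixes h m a1 :: nat
  assumes m: "m > 0" and h: "h > 0" and a1: "a1 > 0"
  defines "degr \<equiv> \<lambda>d. totient (2 * d) * (if even (d div gcd d h) \<and>
      (\<forall>p. prime p \<longrightarrow> p dvd a1 \<longrightarrow> p dvd 2 * d \<and> (p = 2 \<longrightarrow> 8 dvd 2 * d))
      then d div gcd d h div 2 else d div gcd d h)"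
  shows "(\<lambda>k. of_int (moebius (Suc k)) / real (degr (m * Suc k))) sums
    (real (gcd m h) / (2 * (real m)\<^sup>2)
    * (\<Prod>l | prime l \<and> l dvd 2 * m. ((real l)\<^sup>2 - real l) / ((real l)\<^sup>2 - real l - 1))
    * (\<Prod>l | prime l \<and> l dvd h \<and> \<not> l dvd 2 * m.
        ((real l)\<^sup>2 - 2 * real l) / ((real l)\<^sup>2 - real l - 1))
    * (\<Prod>l | prime l \<and> l dvd 2 * m \<and> val l (of_nat m / of_nat h) \<ge> 0. (real l + 1) / real l)
    * (1 + tau h a1 m * (\<Prod>l | prime l \<and> l dvd a1 \<and> \<not> l dvd 2 * m.
        - real (gcd l h) / ((real l)\<^sup>2 - real l - real (gcd l h))))
    * artin_constant)"
proof -
  let ?E = "\<lambda>d. even (d div gcd d h) \<and>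
      (\<forall>p. prime p \<longrightarrow> p dvd a1 \<longrightarrow> p dvd 2 * d \<and> (p = 2 \<longrightarrow> 8 dvd 2 * d))"
  let ?tau = "tau h a1 m"
  define t where "t = (\<lambda>l. - local_ratio h m l)"
  define Q' where "Q' = {l. prime l \<and> l dvd a1 \<and> \<not> l dvd 2 * m}"
  define Q where "Q = Q' \<union> (if ?tau = - 1 / 3 then {2} else {})"
  define D1 where "D1 = {l. prime l \<and> l dvd 2 * m}"
  define D2 where "D2 = {l. prime l \<and> l dvd h \<and> \<not> l dvd 2 * m}"
  define \<alpha> :: "nat \<Rightarrow> real" where "\<alpha> = (\<lambda>l. if prime l then 1 - 1 / ((real l)\<^sup>2 - real l) else 1)"
  define u :: "nat \<Rightarrow> real" where "u = (\<lambda>l. if prime l then 1 + t l else 1)"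
  define v :: "nat \<Rightarrow> real" where "v = (\<lambda>l. if prime l then if l \<in> Q then t l else 1 + t l else 1)"
  have finQ': "finite Q'" unfolding Q'_def
    by (rule finite_subset[of _ "{..a1}"]) (use a1 in \<open>auto dest: dvd_imp_le\<close>)
  have finD1: "finite D1" unfolding D1_def
    by (rule finite_subset[of _ "{..2 * m}"]) (use m in \<open>auto dest: dvd_imp_le\<close>)
  have finD2: "finite D2" unfolding D2_def
    by (rule finite_subset[of _ "{..h}"]) (use h in \<open>auto dest: dvd_imp_le\<close>)
  have finQ: "finite Q" using finQ' by (simp add: Q_def)
  have Qp: "prime l" if "l \<in> Q" for l using that by (auto simp: Q_def Q'_def split: if_splits)

  have generic: "local_ratio h m l = 1 / ((real l)\<^sup>2 - real l)"
    if "prime l" "l \<notin> D1" "l \<notin> D2" for l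
  proof -
    have "\<not> l dvd 2 * m" "\<not> l dvd h" using that by (auto simp: D1_def D2_def)
    moreover from this have "gcd l h = 1"
      using that(1) by (metis coprime_imp_gcd_eq_1 prime_imp_coprime)
    ultimately show ?thesis using local_ratio_unramified[OF that(1) _ h] by simp
  qed
  have summ_t: "summable (\<lambda>p. if prime p then \<bar>t p\<bar> else 0)"
  proof (rule summable_prime_bound)
    obtain N where N: "D1 \<union> D2 \<subseteq> {..N}"
      using finD1 finD2 finite_nat_iff_bounded_le[of "D1 \<union> D2"] by blast
    have "prime p \<longrightarrow> \<bar>t p\<bar> \<le> 2 / (real p)\<^sup>2" if "p > N" for p
    proof
      assume p: "prime p"
      have "p \<notin> D1" "p \<notin> D2" using that N by auto
      then have "\<bar>t p\<bar> = 1 / ((real p)\<^sup>2 - real p)"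
        using generic[OF p] inverse_square_diff_bound(1)[OF p] by (simp add: t_def)
      then show "\<bar>t p\<bar> \<le> 2 / (real p)\<^sup>2" using inverse_square_diff_bound(3)[OF p] by simp
    qed
    then show "\<forall>\<^sub>F p in sequentially. prime p \<longrightarrow> \<bar>t p\<bar> \<le> 2 / (real p)\<^sup>2"
      by (rule eventually_mono[OF eventually_gt_at_top[of N]])
  qed
  have u: "convergent_prod u" "squarefree_prod {} t sums prodinf u"
    using squarefree_euler_product[OF summ_t, of "{}", unfolded empty_iff if_False, folded u_def]
    by auto
  have v: "squarefree_prod Q t sums prodinf v"
    using squarefree_euler_product(2)[OF summ_t finQ Qp] by (simp add: v_def)
  have \<alpha>: "convergent_prod \<alpha>"
  proof -
    have "summable (\<lambda>p. if prime p then \<bar>- (1 / ((real p)\<^sup>2 - real p))\<bar> else 0)"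
    proof (rule summable_prime_bound, intro always_eventually allI impI)
      show "\<bar>- (1 / ((real p)\<^sup>2 - real p))\<bar> \<le> 2 / (real p)\<^sup>2" if "prime p" for p :: nat
        using inverse_square_diff_bound[OF that] by simp
    qed
    from squarefree_euler_product(1)[OF this, of "{}", unfolded empty_iff if_False add_uminus_conv_diff]
    show ?thesis by (simp add: \<alpha>_def)
  qed
  have \<alpha>_pos: "\<alpha> l > 0" for l
    using inverse_square_diff_bound(2)[of l] by (auto simp: \<alpha>_def)
  have u_pos: "u l > 0" for l using local_ratio_pos(2)[of l h m] by (auto simp: u_def t_def)
  have artin: "artin_constant = prodinf \<alpha>" by (simp add: artin_constant_def \<alpha>_def)

  have term_eq: "of_int (moebius k) / real (degr (m * k)) =
      weight h m * (squarefree_prod {} t k + (if ?tau \<noteq> 0 then squarefree_prod Q t k else 0))" for k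
  proof (cases "squarefree k")
    case True
    then have "k > 0" by (metis not_squarefree_0 neq0_conv)
    let ?d = "m * k"
    have d: "?d > 0" using m \<open>k > 0\<close> by simp
    have q: "real (?d div gcd ?d h) = real ?d / real (gcd ?d h)"
      by (rule real_of_nat_div) simp
    \<comment> \<open>A halved degree doubles the reciprocal, and 2 = 1 + 1 splits the series into
      the full sum and the one restricted to multiples.\<close>
    have "1 / real (degr ?d) = weight h ?d * (if ?E ?d then 2 else 1)"
    proof (cases "?E ?d")
      case True
      have "real (?d div gcd ?d h div 2) = real (?d div gcd ?d h) / 2"
        using True by (simp add: real_of_nat_div)
      moreover have "degr ?d = totient (2 * ?d) * (?d div gcd ?d h div 2)"
        by (simp only: degr_def if_P[OF True])
      ultimately have "real (degr ?d) = real (totient (2 * ?d)) * (real ?d / real (gcd ?d h) / 2)"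
        using q by simp
      then have "1 / real (degr ?d) = weight h ?d * 2" by (simp add: weight_def)
      then show ?thesis by (simp only: if_P[OF True])
    next
      case False
      have "degr ?d = totient (2 * ?d) * (?d div gcd ?d h)"
        by (simp only: degr_def if_not_P[OF False])
      then have "real (degr ?d) = real (totient (2 * ?d)) * (real ?d / real (gcd ?d h))"
        using q by simp
      then have "1 / real (degr ?d) = weight h ?d" by (simp add: weight_def)
      then show ?thesis by (simp only: if_not_P[OF False] mult_1_right)
    qed
    moreover have E: "?E ?d \<longleftrightarrow> ?tau \<noteq> 0 \<and> Q \<subseteq> prime_factors k"
      unfolding Q_def Q'_def by (rule entanglement_condition[OF m h True])
    ultimately have "1 / real (degr ?d)
        = weight h ?d * (if ?tau \<noteq> 0 \<and> Q \<subseteq> prime_factors k then 2 else 1)"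
      by (simp only: E)
    moreover have mt: "of_int (moebius k) * (\<Prod>p\<in>prime_factors k. local_ratio h m p)
        = (\<Prod>p\<in>prime_factors k. t p)"
      using True by (simp add: moebius_def t_def prod_uminus)
    moreover have "of_int (moebius k) / real (degr ?d) = of_int (moebius k) * (1 / real (degr ?d))"
      by simp
    ultimately have "of_int (moebius k) / real (degr ?d) = weight h m * ((\<Prod>p\<in>prime_factors k. t p) *
        (if ?tau \<noteq> 0 \<and> Q \<subseteq> prime_factors k then 2 else 1))"
      unfolding weight_mult_squarefree[OF m h True] mt[symmetric] by (simp only: mult_ac)
    then show ?thesis using True by (simp add: squarefree_prod_def)
  qed (simp add: moebius_def squarefree_prod_def)
  have "(\<lambda>k. weight h m * (squarefree_prod {} t k + (if ?tau \<noteq> 0 then squarefree_prod Q t k else 0)))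
      sums (weight h m * (prodinf u + (if ?tau \<noteq> 0 then prodinf v else 0)))"
    using u(2) v by (intro sums_mult sums_add) auto
  then have "(\<lambda>k. of_int (moebius k) / real (degr (m * k))) sums
      (weight h m * (prodinf u + (if ?tau \<noteq> 0 then prodinf v else 0)))"
    by (simp only: term_eq)
  \<comment> \<open>The index can be shifted because 0 is not squarefree, so its term
    vanishes.\<close>
  then have sums: "(\<lambda>k. of_int (moebius (Suc k)) / real (degr (m * Suc k))) sums
      (weight h m * (prodinf u + (if ?tau \<noteq> 0 then prodinf v else 0)))"
    by (subst sums_Suc_iff) (simp add: moebius_def)

  have v_eq: "(if ?tau \<noteq> 0 then prodinf v else 0) = ?tau * (\<Prod>l\<in>Q'.
        - real (gcd l h) / ((real l)\<^sup>2 - real l - real (gcd l h))) * prodinf u"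
  proof (cases "?tau = 0")
    case False
    have "prodinf v = (\<Prod>l\<in>Q. v l / u l) * prodinf u"
    proof (rule prodinf_finite_change[OF u(1) finQ])
      show "v l = u l" if "l \<notin> Q" for l using that by (simp add: u_def v_def)
      show "u l \<noteq> 0" for l using u_pos[of l] by simp
    qed
    also have "(\<Prod>l\<in>Q. v l / u l) = (\<Prod>l\<in>Q. t l / (1 + t l))"
      by (rule prod.cong) (auto simp: u_def v_def Qp)
    also have "\<dots> = ?tau * (\<Prod>l\<in>Q'. t l / (1 + t l))"
    proof (cases "?tau = - 1 / 3")
      case True
      have "2 \<notin> Q'" by (simp add: Q'_def)
      \<comment> \<open>In this case the valuation of h at 2 does not exceed that of m, so the local
        ratio at 2 is 1/4 and t = -1/4.\<close>
      moreover have "t 2 / (1 + t 2) = - 1 / 3"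
        using tau_minus_third_multiplicity[OF True] by (simp add: t_def local_ratio_def)
      ultimately show ?thesis using True finQ' by (simp add: Q_def)
    next
      case neq: False
      then have "?tau = 1" using tau_cases[of h a1 m] False by blast
      then show ?thesis by (simp add: Q_def)
    qed
    also have "(\<Prod>l\<in>Q'. t l / (1 + t l))
        = (\<Prod>l\<in>Q'. - real (gcd l h) / ((real l)\<^sup>2 - real l - real (gcd l h)))"
    proof (rule prod.cong[OF refl])
      fix l assume "l \<in> Q'"
      then have l: "prime l" "\<not> l dvd 2 * m" by (auto simp: Q'_def)
      have "(real l)\<^sup>2 - real l > 0" using inverse_square_diff_bound(1)[OF l(1)] by simp
      then show "t l / (1 + t l) = - real (gcd l h) / ((real l)\<^sup>2 - real l - real (gcd l h))"
      proof -
        have "- (c / s) / (1 + - (c / s)) = - c / (s - c)" if "s > 0" for c s :: real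
        proof -
          have "1 + - (c / s) = (s - c) / s" using that by (simp add: field_simps)
          then show ?thesis using that by simp
        qed
        from this[OF \<open>(real l)\<^sup>2 - real l > 0\<close>] show ?thesis
          unfolding t_def local_ratio_unramified[OF l h] .
      qed
    qed
    finally show ?thesis using False by simp
  qed simp

  have "prodinf u = (\<Prod>l\<in>D1 \<union> D2. u l / \<alpha> l) * prodinf \<alpha>"
  proof (rule prodinf_finite_change[OF \<alpha>])
    show "u l = \<alpha> l" if "l \<notin> D1 \<union> D2" for l
      using that generic[of l] by (simp add: u_def \<alpha>_def t_def)
    show "\<alpha> l \<noteq> 0" for l using \<alpha>_pos[of l] by simp
  qed (use finD1 finD2 in simp)
  also have "(\<Prod>l\<in>D1 \<union> D2. u l / \<alpha> l) = (\<Prod>l\<in>D1. u l / \<alpha> l) * (\<Prod>l\<in>D2. u l / \<alpha> l)"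
    by (rule prod.union_disjoint[OF finD1 finD2]) (auto simp: D1_def D2_def)
  also have "(\<Prod>l\<in>D2. u l / \<alpha> l)
      = (\<Prod>l\<in>D2. ((real l)\<^sup>2 - 2 * real l) / ((real l)\<^sup>2 - real l - 1))"
  proof (rule prod.cong[OF refl])
    fix l assume "l \<in> D2"
    then have l: "prime l" "\<not> l dvd 2 * m" "l dvd h" by (auto simp: D2_def)
    have pos: "(real l)\<^sup>2 - real l > 0" using inverse_square_diff_bound(1)[OF l(1)] by simp
    have "gcd l h = l" using l(3) by (simp add: gcd_nat.absorb1)
    then have "u l = ((real l)\<^sup>2 - 2 * real l) / ((real l)\<^sup>2 - real l)"
      using l(1) pos by (simp add: u_def t_def local_ratio_unramified[OF l(1,2) h] field_simps)
    moreover have "\<alpha> l = ((real l)\<^sup>2 - real l - 1) / ((real l)\<^sup>2 - real l)"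
      using l(1) pos by (simp add: \<alpha>_def field_simps)
    ultimately show "u l / \<alpha> l = ((real l)\<^sup>2 - 2 * real l) / ((real l)\<^sup>2 - real l - 1)"
      using pos by simp
  qed
  also have "(\<Prod>l\<in>D1. u l / \<alpha> l) = (\<Prod>l\<in>D1. 1 - 1 / real l)
      * (\<Prod>l\<in>D1. if val l (of_nat m / of_nat h) \<ge> 0 then (real l + 1) / real l else 1)
      * (\<Prod>l\<in>D1. ((real l)\<^sup>2 - real l) / ((real l)\<^sup>2 - real l - 1))"
    unfolding prod.distrib[symmetric]
  proof (rule prod.cong[OF refl])
    fix l assume "l \<in> D1"
    then have l: "prime l" "l dvd 2 * m" by (auto simp: D1_def)
    have pos: "(real l)\<^sup>2 - real l > 0" using inverse_square_diff_bound(1)[OF l(1)] by simp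
    have l0: "real l > 0" using prime_gt_0_nat[OF l(1)] by simp
    have \<alpha>_eq: "\<alpha> l = ((real l)\<^sup>2 - real l - 1) / ((real l)\<^sup>2 - real l)"
      using l(1) pos by (simp add: \<alpha>_def field_simps)
    \<comment> \<open>The ratio is 1/l if h has the higher power of l, and 1/l^2 otherwise; in the
      second case 1 - 1/l^2 splits off the extra factor (l + 1) / l.\<close>
    have "u l = (1 - 1 / real l)
        * (if val l (of_nat m / of_nat h) \<ge> 0 then (real l + 1) / real l else 1)"
      using l l0 unfolding val_of_nat_div_nonneg_iff[OF m h l(1)]
      by (auto simp: u_def t_def local_ratio_def field_simps)
    then show "u l / \<alpha> l = (1 - 1 / real l)
        * (if val l (of_nat m / of_nat h) \<ge> 0 then (real l + 1) / real l else 1)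
        * (((real l)\<^sup>2 - real l) / ((real l)\<^sup>2 - real l - 1))"
      unfolding \<alpha>_eq by simp
  qed
  also have "(\<Prod>l\<in>D1. if val l (of_nat m / of_nat h) \<ge> 0 then (real l + 1) / real l else 1)
      = (\<Prod>l | prime l \<and> l dvd 2 * m \<and> val l (of_nat m / of_nat h) \<ge> 0. (real l + 1) / real l)"
    using finD1 by (subst prod.inter_filter[symmetric]) (auto simp: D1_def intro!: prod.cong)
  finally have u_eq: "prodinf u = (\<Prod>l\<in>D1. 1 - 1 / real l)
      * (\<Prod>l | prime l \<and> l dvd 2 * m \<and> val l (of_nat m / of_nat h) \<ge> 0. (real l + 1) / real l)
      * (\<Prod>l\<in>D1. ((real l)\<^sup>2 - real l) / ((real l)\<^sup>2 - real l - 1))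
      * (\<Prod>l\<in>D2. ((real l)\<^sup>2 - 2 * real l) / ((real l)\<^sup>2 - real l - 1)) * prodinf \<alpha>" .
  have D1_pf: "D1 = prime_factors (2 * m)" using m by (auto simp: D1_def prime_factors_dvd)
  have "real (totient (2 * m)) = real (2 * m) * (\<Prod>l\<in>D1. 1 - 1 / real l)"
    unfolding D1_pf by (rule totient_formula2)
  moreover have "real (totient (2 * m)) > 0" using m by simp
  \<comment> \<open>The factors 1 - 1/l over the primes of 2m cancel against the totient of 2m in
    the weight, leaving 2m times m in the denominator.\<close>
  ultimately have weight_eq: "weight h m * (\<Prod>l\<in>D1. 1 - 1 / real l) = real (gcd m h) / (2 * (real m)\<^sup>2)"
    using m by (auto simp: weight_def power2_eq_square field_simps)
  have rearrange: "w * (p * d * b * c * a + s * q * (p * d * b * c * a))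
      = w * p * b * c * d * (1 + s * q) * a" for w p d b c a s q :: real
    by (simp add: algebra_simps)
  show ?thesis
    using sums unfolding v_eq u_eq rearrange weight_eq artin D1_def[symmetric] D2_def[symmetric] Q'_def[symmetric] .
qed

theorem theorem5:
  fixes a a0 a2 :: rat and a1 h m :: nat
  assumes "a > 0" and "a \<noteq> 1"
    and "a0 > 0" and "\<nexists>(b::rat) n::nat. n \<ge> 2 \<and> a0 = b ^ n"
    and "h \<ge> 1" and "a = a0 ^ h"
    and "a2 > 0" and "a1 > 1" and "squarefree a1" and "a0 = of_nat a1 * a2\<^sup>2"
    and "m \<ge> 1"
  shows "rho (generate rat_units {- 1, a}) m =
    of_nat (gcd m h) / (2 * (of_nat m)\<^sup>2)
    * (\<Prod>l | prime l \<and> l dvd 2 * m.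
        ((of_nat l)\<^sup>2 - of_nat l) / ((of_nat l)\<^sup>2 - of_nat l - 1))
    * (\<Prod>l | prime l \<and> l dvd h \<and> \<not> l dvd 2 * m.
        ((of_nat l)\<^sup>2 - 2 * of_nat l) / ((of_nat l)\<^sup>2 - of_nat l - 1))
    * (\<Prod>l | prime l \<and> l dvd 2 * m \<and> val l (of_nat m / of_nat h) \<ge> 0.
        (of_nat l + 1) / of_nat l)
    * (1 + tau h a1 m * (\<Prod>l | prime l \<and> l dvd a1 \<and> \<not> l dvd 2 * m.
        - of_nat (gcd l h) / ((of_nat l)\<^sup>2 - of_nat l - of_nat (gcd l h))))
    * artin_constant"
proof -
  let ?G = "generate rat_units {- 1, a}"
  have pos: "h > 0" "m > 0" "a1 > 0" using assms by simp_all
  have dim: "ring.dim complex_field \<rat> (kummer_field ?G (m * Suc k)) =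
      totient (2 * (m * Suc k)) * (if even (m * Suc k div gcd (m * Suc k) h) \<and>
        (\<forall>p. prime p \<longrightarrow> p dvd a1 \<longrightarrow>
          p dvd 2 * (m * Suc k) \<and> (p = 2 \<longrightarrow> 8 dvd 2 * (m * Suc k)))
        then m * Suc k div gcd (m * Suc k) h div 2 else m * Suc k div gcd (m * Suc k) h)" for k
    using pos by (intro kummer_field_degree[OF assms(3,4) pos(1) assms(6,9,10)]) simp
  show ?thesis
    unfolding rho_def dim
    by (rule sums_unique[OF sums_reciprocal_degrees[OF pos(2,1,3)], symmetric])
qed

end
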